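(* Let $T$ be a proper rooted binary tree with $n$ leaves labeled $1,\ldots,n$ in left-to-right order, each internal node $v$ labeled with $q_v\in[\tfrac12,1]$, and suppose the probabilities $p_{i,j}$ have league structure $T$, i.e. $p_{i,j}=q_{i\vee j}$ and $p_{j,i}=1-p_{i,j}$ for all $1\le i<j\le n$. Then the mixing time of $\mathcal{M}_{tree}(T)$ satisfies $\tau_{tree}(\epsilon)=O(n^5\log(n/\epsilon))$. If moreover each $q_v>1/2$ is a constant (bounded away from $1/2$ independently of $n$), then $\tau_{tree}(\epsilon)=O(n^3\log n\,\log(n/\epsilon))$.
   Context: For leaves $i,j$ of $T$, $i\vee j$ denotes their lowest common ancestor. Permutations $\sigma\in S_n$ are lists $\sigma(1),\ldots,\sigma(n)$; the target distribution is $\pi(\sigma)=Z^{-1}\prod_{a\text{ before }b\text{ in }\sigma}p_{a,b}$. $\mathcal{M}_{tree}(T)$: from $\sigma_t$, select distinct $a,b\in[n]$ uniformly at random, with $a<b$. If every element located strictly between $a$ and $b$ in $\sigma_t$ is not a leaf-descendant in $T$ of $a\vee b$, obtain $\sigma_{t+1}$ by placing $a,b$ (in the two positions they occupy) in order ($a$ first) with probability $p_{a,b}$ and out of order with probability $1-p_{a,b}$, leaving all other elements fixed. Otherwise $\sigma_{t+1}=\sigma_t$. Mixing time: $\tau(\epsilon)=\min\{t:\|\mathcal{P}^{t'},\pi\|_{tv}\le\epsilon\ \forall t'\ge t\}$, where $\|\mathcal{P}^t,\pi\|_{tv}=\max_x\frac12\sum_y|\mathcal{P}^t(x,y)-\pi(y)|$.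 The $O(\cdot)$ bounds are as $n\to\infty$ with constants independent of $n$ and $\epsilon$. *)

theory Defs
  imports "HOL-Probability.Probability" "HOL-Combinatorics.Multiset_Permutations"
begin

datatype ltree = Leaf nat | Node real ltree ltree

primrec leaves :: "ltree \<Rightarrow> nat list" where
  "leaves (Leaf k) = [k]"
| "leaves (Node q l r) = leaves l @ leaves r"

primrec node_labels :: "ltree \<Rightarrow> real set" where
  "node_labels (Leaf k) = {}"
| "node_labels (Node q l r) = insert q (node_labels l \<union> node_labels r)"

text \<open>A node of a tree is identified with the subtree rooted at it; this is unambiguous
  because the leaf labels of the trees considered are distinct.\<close>

primrec subtrees :: "ltree \<Rightarrow> ltree set" where
  "subtrees (Leaf k) = {Leaf k}"
| "subtrees (Node q l r) = insert (Node q l r) (subtrees l \<union> subtrees r)"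

primrec lca :: "ltree \<Rightarrow> nat \<Rightarrow> nat \<Rightarrow> ltree" where
  "lca (Leaf k) i j = Leaf k"
| "lca (Node q l r) i j =
     (if {i, j} \<subseteq> set (leaves l) then lca l i j
      else if {i, j} \<subseteq> set (leaves r) then lca r i j
      else Node q l r)"

lemma subtrees_self: "t \<in> subtrees t"
  by (cases t) auto

lemma leaves_subtree: "s \<in> subtrees t \<Longrightarrow> set (leaves s) \<subseteq> set (leaves t)"
  by (induction t) auto

text \<open>The recursion computes the lowest common ancestor: a common ancestor of the two leaves
  that is a descendant of every common ancestor.\<close>

lemma lca_lowest_common_ancestor:
  assumes "distinct (leaves t)" "{i, j} \<subseteq> set (leaves t)"
  shows "lca t i j \<in> subtrees t" "{i, j} \<subseteq> set (leaves (lca t i j))"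
    and "\<And>s. s \<in> subtrees t \<Longrightarrow> {i, j} \<subseteq> set (leaves s) \<Longrightarrow> lca t i j \<in> subtrees s"
proof -
  have "lca t i j \<in> subtrees t \<and> {i, j} \<subseteq> set (leaves (lca t i j)) \<and>
    (\<forall>s\<in>subtrees t. {i, j} \<subseteq> set (leaves s) \<longrightarrow> lca t i j \<in> subtrees s)"
    using assms
  proof (induction t)
    case (Node q l r)
    consider (left) "{i, j} \<subseteq> set (leaves l)" | (right) "{i, j} \<subseteq> set (leaves r)"
      "\<not> {i, j} \<subseteq> set (leaves l)"
      | (split) "\<not> {i, j} \<subseteq> set (leaves l)" "\<not> {i, j} \<subseteq> set (leaves r)"
      by blast
    then show ?case
    proof cases
      case left
      then have eq: "lca (Node q l r) i j = lca l i j" by simp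
      have "\<not> {i, j} \<subseteq> set (leaves s)" if "s \<in> subtrees r" for s
        using leaves_subtree[OF that] left Node.prems(1) by auto
      then show ?thesis
        unfolding eq using Node.IH(1) Node.prems(1) left by auto
    next
      case right
      then have eq: "lca (Node q l r) i j = lca r i j" by auto
      have "\<not> {i, j} \<subseteq> set (leaves s)" if "s \<in> subtrees l" for s
        using leaves_subtree[OF that] right by blast
      then show ?thesis
        unfolding eq using Node.IH(2) Node.prems(1) right by auto
    next
      case split
      then have eq: "lca (Node q l r) i j = Node q l r" by auto
      have "\<not> {i, j} \<subseteq> set (leaves s)" if "s \<in> subtrees l \<union> subtrees r" for s
        using that leaves_subtree[of s] split by blast
      then show ?thesis
        unfolding eq using Node.prems(2) by auto
    qed
  qed auto
  then show "lca t i j \<in> subtrees t" "{i, j} \<subseteq> set (leaves (lca t i j))"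
    and "\<And>s. s \<in> subtrees t \<Longrightarrow> {i, j} \<subseteq> set (leaves s) \<Longrightarrow> lca t i j \<in> subtrees s"
    by blast+
qed

text \<open>Only ever applied to internal nodes: the lowest common ancestor of two distinct leaves
  is internal.\<close>

fun root_label :: "ltree \<Rightarrow> real" where
  "root_label (Node q l r) = q"
| "root_label (Leaf k) = undefined"

definition league_structure :: "nat \<Rightarrow> ltree \<Rightarrow> (nat \<Rightarrow> nat \<Rightarrow> real) \<Rightarrow> bool" where
  "league_structure n T p \<longleftrightarrow>
     (\<forall>i j. 1 \<le> i \<and> i < j \<and> j \<le> n \<longrightarrow>
        p i j = root_label (lca T i j) \<and> p j i = 1 - p i j)"

abbreviation perms :: "nat \<Rightarrow> nat list set" where
  "perms n \<equiv> permutations_of_set {1..n}"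

definition weight :: "(nat \<Rightarrow> nat \<Rightarrow> real) \<Rightarrow> nat list \<Rightarrow> real" where
  "weight p \<sigma> = (\<Prod>(k, l)\<in>{(k, l). k < l \<and> l < length \<sigma>}. p (\<sigma> ! k) (\<sigma> ! l))"

definition target :: "nat \<Rightarrow> (nat \<Rightarrow> nat \<Rightarrow> real) \<Rightarrow> nat list \<Rightarrow> real" where
  "target n p \<sigma> = weight p \<sigma> / (\<Sum>\<rho>\<in>perms n. weight p \<rho>)"

definition pos :: "nat list \<Rightarrow> nat \<Rightarrow> nat" where
  "pos \<sigma> x = (THE k. k < length \<sigma> \<and> \<sigma> ! k = x)"

definition between :: "nat list \<Rightarrow> nat \<Rightarrow> nat \<Rightarrow> nat set" where
  "between \<sigma> a b =
     {\<sigma> ! k | k. min (pos \<sigma> a) (pos \<sigma> b) < k \<and> k < max (pos \<sigma> a) (pos \<sigma> b)}"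

text \<open>The elements x and y are put, x first, into the two positions they occupy.\<close>

definition place :: "nat list \<Rightarrow> nat \<Rightarrow> nat \<Rightarrow> nat list" where
  "place \<sigma> x y =
     \<sigma>[min (pos \<sigma> x) (pos \<sigma> y) := x, max (pos \<sigma> x) (pos \<sigma> y) := y]"

definition tree_step ::
  "nat \<Rightarrow> ltree \<Rightarrow> (nat \<Rightarrow> nat \<Rightarrow> real) \<Rightarrow> nat list \<Rightarrow> nat list pmf" where
  "tree_step n T p \<sigma> =
     bind_pmf (pmf_of_set {(a, b). 1 \<le> a \<and> a < b \<and> b \<le> n}) (\<lambda>(a, b).
       if between \<sigma> a b \<inter> set (leaves (lca T a b)) = {}
       then map_pmf (\<lambda>in_order. if in_order then place \<sigma> a b else place \<sigma> b a)
              (bernoulli_pmf (p a b))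
       else return_pmf \<sigma>)"

definition chain_dist :: "('s \<Rightarrow> 's pmf) \<Rightarrow> nat \<Rightarrow> 's \<Rightarrow> 's pmf" where
  "chain_dist K t x = ((\<lambda>D. bind_pmf D K) ^^ t) (return_pmf x)"

definition tv_dist :: "'s set \<Rightarrow> ('s \<Rightarrow> 's pmf) \<Rightarrow> ('s \<Rightarrow> real) \<Rightarrow> nat \<Rightarrow> real" where
  "tv_dist S K \<mu> t =
     (MAX x\<in>S. (1/2) * (\<Sum>y\<in>S. \<bar>pmf (chain_dist K t x) y - \<mu> y\<bar>))"

text \<open>The value is infinite if there is no such time.\<close>

definition mixing_time ::
  "'s set \<Rightarrow> ('s \<Rightarrow> 's pmf) \<Rightarrow> ('s \<Rightarrow> real) \<Rightarrow> real \<Rightarrow> enat" where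
  "mixing_time S K \<mu> \<epsilon> = Inf (enat ` {t. \<forall>t'\<ge>t. tv_dist S K \<mu> t' \<le> \<epsilon>})"

definition tau_tree :: "nat \<Rightarrow> ltree \<Rightarrow> (nat \<Rightarrow> nat \<Rightarrow> real) \<Rightarrow> real \<Rightarrow> enat" where
  "tau_tree n T p \<epsilon> = mixing_time (perms n) (tree_step n T p) (target n p) \<epsilon>"

end

theory Submission
  imports Defs
begin

text \<open>
  A permutation amounts to one binary word per internal node, recording the order in which the
  leaves of the left (\<open>True\<close>) and right (\<open>False\<close>) subtree appear. A move on a pair of leaves
  exchanges two adjacent letters of the word at their lowest common ancestor and changes no other
  word, so the chain is a product of asymmetric exclusion processes, in which each adjacent pair of
  each word is updated with probability one over the number of pairs of leaves.

  Path coupling is used in its dual form: the transition operator contracts the Lipschitz seminorm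
  of functions for the weighted graph whose edges are the single exchanges. In a word of length
  \<open>m\<close> the exchange at positions \<open>j, j + 1\<close> preceded by \<open>s\<close> letters \<open>True\<close> has weight
  \<open>y ^ (j - 2 * s) * (j + 1) * (m - 1 - j)\<close> with \<open>y = sqrt (q / (1 - q))\<close>, which makes the
  contraction rate at least \<open>4 / n\<^sup>2\<close> in general and constant if \<open>q\<close> is bounded away from
  \<open>1/2\<close>. The diameter is exponential in \<open>n\<close>, so its logarithm costs one further factor \<open>n\<close>.
\<close>

text \<open>With equal weights there is no contraction: the update of the exchanged pair itself
  removes the edge, while the updates of the two overlapping pairs create new edges, each with
  probability \<open>q\<close> or \<open>1 - q\<close> depending on the neighbouring letter. Away
  from the ends of the word the balance is zero for \<open>q = 1/2\<close> and can be unfavourable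
  for larger \<open>q\<close>. The factor \<open>y ^ (j - 2 * s)\<close>, exponential in the height
  of the lattice path coded by the word, turns the amount created into \<open>2 * q / y\<close>,
  which is \<open>2 * sqrt (q * (1 - q))\<close> below the cap and at most 1; the parabola makes the
  inequality strict even where this is 1. Functions replace couplings because the expectation after
  \<open>t + 1\<close> steps is that of the averaged function after \<open>t\<close> steps, and
  averaging keeps the mean under the target distribution. Total variation is recovered from the sign
  of the difference of the two distributions, a test function whose seminorm is controlled by the
  smallest weight.\<close>

section \<open>Exclusion on a single word\<close>

text \<open>With \<open>y = sqrt (q / (1 - q))\<close> the weights below are exactly harmonic up to the parabola
  \<open>(j + 1) * (m - 1 - j)\<close>, for every bias. Capping the bias at \<open>8/9\<close> keeps all weights between
  \<open>3 ^ (- n)\<close> and \<open>3 ^ n * n\<^sup>2\<close> even for \<open>q\<close> close to \<open>1\<close>, at the price of an inequality that still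
  leaves a constant rate.\<close>

definition tilt :: "real \<Rightarrow> real" where
  "tilt q = sqrt (min q (8/9) / (1 - min q (8/9)))"

text \<open>The weight of exchanging the letters at positions \<open>j\<close> and \<open>j + 1\<close> (counted from 0) of a word
  of length \<open>m\<close> whose first \<open>j\<close> letters contain \<open>s\<close> times \<open>True\<close>.\<close>

definition tile_weight :: "real \<Rightarrow> nat \<Rightarrow> nat \<Rightarrow> nat \<Rightarrow> real" where
  "tile_weight q m j s =
     tilt q ^ j / (tilt q ^ 2) ^ s * (real j + 1) * (real m - 1 - real j)"

definition flip :: "real \<Rightarrow> nat \<Rightarrow> (bool list \<Rightarrow> real) \<Rightarrow> bool list \<Rightarrow> real" where
  "flip q k g w =
     (if w ! k = w ! Suc k then g w
      else q * g (w[k := True, Suc k := False]) + (1 - q) * g (w[k := False, Suc k := True]))"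

section \<open>Estimates for the tilt and for the weights of a single word\<close>

lemma tilt_square:
  assumes "1/2 \<le> q"
  shows "tilt q ^ 2 = min q (8/9) / (1 - min q (8/9))"
  unfolding tilt_def using assms by (intro real_sqrt_pow2) (auto simp: min_def)

lemma tilt_bounds:
  assumes "1/2 \<le> q"
  shows "1 \<le> tilt q" "tilt q \<le> 3"
proof -
  have "1 \<le> min q (8/9) / (1 - min q (8/9))" "min q (8/9) / (1 - min q (8/9)) \<le> 9"
    using assms by (auto simp: min_def field_simps)
  then show "1 \<le> tilt q" "tilt q \<le> 3"
    unfolding tilt_def by (auto intro: real_le_lsqrt)
qed

text \<open>An equality up to the cap \<open>8/9\<close>; beyond it the odds
  \<open>q / (1 - q)\<close> exceed the capped ones. A move of probability \<open>1 - q\<close> can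
  thereby be charged like a move of probability \<open>q\<close> at a weight smaller by the factor
  \<open>tilt q ^ 2\<close>.\<close>

lemma one_minus_le_tilt:
  assumes "1/2 \<le> q"
  shows "1 - q \<le> q / tilt q ^ 2"
proof -
  let ?r = "min q (8/9)"
  have r: "1/2 \<le> ?r" "?r \<le> 8/9" "?r \<le> q" using assms by auto
  have "(1 - q) * ?r \<le> q * (1 - ?r)"
    using r by (auto simp: algebra_simps)
  then show ?thesis
    unfolding tilt_square[OF assms] using r by (auto simp: field_simps)
qed

text \<open>Squaring removes the root. Below the cap the square is
  \<open>4 * q * (1 - q) = 1 - 4 * (q - 1/2)^2\<close>, at most \<open>1 - 2 * \<gamma>\<close>;
  above it \<open>tilt q ^ 2 = 8\<close> and the square is \<open>q^2 / 2\<close>. The second range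
  is the source of the bound \<open>1/4\<close> on \<open>\<gamma>\<close>, as
  \<open>(3/4)^2\<close> exceeds \<open>1/2\<close>.\<close>

lemma drift_le:
  assumes "1/2 \<le> q" "q \<le> 1" "0 \<le> \<delta>" "\<delta> \<le> q - 1/2" "\<gamma> \<le> 2 * \<delta>^2" "\<gamma> \<le> 1/4"
  shows "2 * q / tilt q \<le> 1 - \<gamma>"
proof -
  have t: "1 \<le> tilt q" using tilt_bounds assms by simp
  have \<gamma>1: "0 \<le> 1 - \<gamma>" using assms by simp
  have "(2 * q / tilt q)^2 \<le> (1 - \<gamma>)^2"
  proof (cases "q \<le> 8/9")
    case True
    have "(2 * q / tilt q)^2 = 4 * q^2 / tilt q ^ 2"
      by (simp add: power_divide power_mult_distrib)
    also have "\<dots> = 4 * q * (1 - q)"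
      unfolding tilt_square[OF assms(1)] using True assms
      by (simp add: min_def field_simps power2_eq_square)
    also have "\<dots> = 1 - 4 * (q - 1/2)^2"
      by (simp add: power2_eq_square algebra_simps)
    also have "\<dots> \<le> 1 - 4 * \<delta>^2"
      using assms power_mono[of \<delta> "q - 1/2" 2] by simp
    also have "\<dots> \<le> 1 - 2 * \<gamma>" using assms by simp
    also have "\<dots> \<le> (1 - \<gamma>)^2" by (simp add: power2_eq_square algebra_simps)
    finally show ?thesis .
  next
    case False
    have "(2 * q / tilt q)^2 = 4 * q^2 / tilt q ^ 2"
      by (simp add: power_divide power_mult_distrib)
    also have "\<dots> = q^2 / 2"
      unfolding tilt_square[OF assms(1)] using False by (simp add: min_def)
    also have "\<dots> \<le> 1/2" using assms by (simp add: power_le_one)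
    also have "\<dots> \<le> (3/4)^2" by (simp add: power2_eq_square)
    also have "\<dots> \<le> (1 - \<gamma>)^2" using assms by (intro power_mono) auto
    finally show ?thesis .
  qed
  then show ?thesis using \<gamma>1 power2_le_imp_le by blast
qed

text \<open>The exponent \<open>j - 2 * s\<close> lies between \<open>- j\<close> and
  \<open>j\<close>, the base between 1 and 3, and the parabola between 1 and \<open>n^2\<close>; it
  would vanish at \<open>j = m - 1\<close>.\<close>

lemma tile_weight_bounds:
  assumes "1/2 \<le> q" "s \<le> j" "Suc j < m" "m \<le> n"
  shows "1 / 3 ^ n \<le> tile_weight q m j s" "tile_weight q m j s \<le> 3 ^ n * real n ^ 2"
proof -
  note t = tilt_bounds[OF assms(1)]
  have a: "1 \<le> (real j + 1) * (real m - 1 - real j)"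
    using assms mult_mono[of 1 "real j + 1" 1 "real m - 1 - real j"] by auto
  have b: "(real j + 1) * (real m - 1 - real j) \<le> real n * real n"
    using assms by (intro mult_mono) auto
  have tj: "tilt q ^ j \<le> 3 ^ n"
  proof -
    have "tilt q ^ j \<le> 3 ^ j" using t by (intro power_mono) auto
    also have "\<dots> \<le> 3 ^ n" using assms by (intro power_increasing) auto
    finally show ?thesis .
  qed
  have up: "tilt q ^ j / (tilt q ^ 2) ^ s \<le> 3 ^ n"
  proof -
    have "1 \<le> (tilt q ^ 2) ^ s" using t by (simp add: one_le_power)
    then have "tilt q ^ j / (tilt q ^ 2) ^ s \<le> tilt q ^ j / 1"
      using t by (intro divide_left_mono) auto
    then show ?thesis using tj by simp
  qed
  have lo: "1 / 3 ^ n \<le> tilt q ^ j / (tilt q ^ 2) ^ s"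
  proof -
    have "1 / 3 ^ n \<le> 1 / tilt q ^ j" using tj t by (intro divide_left_mono) auto
    also have "\<dots> = tilt q ^ j / (tilt q ^ 2) ^ j"
      using t by (simp add: power_mult[symmetric] mult_2 power_add)
    also have "\<dots> \<le> tilt q ^ j / (tilt q ^ 2) ^ s"
      using t assms by (intro divide_left_mono power_increasing) (auto simp: one_le_power)
    finally show ?thesis .
  qed
  have p: "0 < tilt q ^ j / (tilt q ^ 2) ^ s" using t by simp
  have "1 / 3 ^ n * 1 \<le> tilt q ^ j / (tilt q ^ 2) ^ s * ((real j + 1) * (real m - 1 - real j))"
    using lo a p by (intro mult_mono) auto
  then show "1 / 3 ^ n \<le> tile_weight q m j s" by (simp add: tile_weight_def mult.assoc)
  have "tilt q ^ j / (tilt q ^ 2) ^ s * ((real j + 1) * (real m - 1 - real j))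
      \<le> 3 ^ n * (real n * real n)"
    using up b a p by (intro mult_mono[OF up b]) auto
  then show "tile_weight q m j s \<le> 3 ^ n * real n ^ 2"
    by (simp add: tile_weight_def power2_eq_square mult.assoc)
qed

text \<open>Here \<open>v\<close> stands for \<open>(j + 1) * (m - 1 - j)\<close>, whose second difference in \<open>j\<close> is \<open>-2\<close>.\<close>

definition contraction_rate :: "nat \<Rightarrow> real \<Rightarrow> real \<Rightarrow> bool" where
  "contraction_rate n \<gamma> q \<longleftrightarrow> 1/2 \<le> q \<and> q \<le> 1 \<and>
     (\<forall>v. 1 \<le> v \<longrightarrow> v \<le> real n ^ 2 / 4 \<longrightarrow> 2 * q / tilt q * (v - 1) \<le> (1 - \<gamma>) * v)"

text \<open>Without a bias the whole gain comes from the concavity of the parabola: losing 1 from a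
  value of at most \<open>n^2 / 4\<close> is a relative gain of at least
  \<open>4 / n^2\<close>.\<close>

lemma contraction_rate_uniform:
  assumes "1/2 \<le> q" "q \<le> 1"
  shows "contraction_rate n (4 / real n ^ 2) q"
  unfolding contraction_rate_def
proof (intro conjI allI impI)
  fix v :: real assume v: "1 \<le> v" "v \<le> real n ^ 2 / 4"
  have "2 * q / tilt q \<le> 1" using drift_le[of q 0 0] assms by simp
  then have "2 * q / tilt q * (v - 1) \<le> 1 * (v - 1)"
    using v by (intro mult_right_mono) auto
  also have "\<dots> \<le> (1 - 4 / real n ^ 2) * v"
  proof -
    have "0 < real n ^ 2 / 4" using v by linarith
    then have "4 / real n ^ 2 * v \<le> 1" using v by (auto simp: field_simps)
    then show ?thesis by (simp add: left_diff_distrib)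
  qed
  finally show "2 * q / tilt q * (v - 1) \<le> (1 - 4 / real n ^ 2) * v" .
qed (use assms in auto)

text \<open>Here the drift factor alone supplies the gain, and passing from \<open>v - 1\<close> to
  \<open>v\<close> gives the parabola away.\<close>

lemma contraction_rate_biased:
  assumes "1/2 + \<delta> \<le> q" "q \<le> 1" "0 \<le> \<delta>"
  shows "contraction_rate n (min (2 * \<delta>^2) (1/4)) q"
  unfolding contraction_rate_def
proof (intro conjI allI impI)
  fix v :: real assume v: "1 \<le> v" "v \<le> real n ^ 2 / 4"
  have d: "2 * q / tilt q \<le> 1 - min (2 * \<delta>^2) (1/4)" using drift_le[of q \<delta>] assms by simp
  have "2 * q / tilt q * (v - 1) \<le> (1 - min (2 * \<delta>^2) (1/4)) * (v - 1)"
    using v d by (intro mult_right_mono) auto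
  also have "\<dots> \<le> (1 - min (2 * \<delta>^2) (1/4)) * v" by (intro mult_left_mono) auto
  finally show "2 * q / tilt q * (v - 1) \<le> (1 - min (2 * \<delta>^2) (1/4)) * v" .
qed (use assms in auto)

lemma tile_weight_nonneg:
  assumes "1/2 \<le> q" "Suc j \<le> m"
  shows "0 \<le> tile_weight q m j s"
  unfolding tile_weight_def using tilt_bounds[OF assms(1)] assms(2)
  by (intro mult_nonneg_nonneg divide_nonneg_nonneg) auto

text \<open>Moving to \<open>j + 1\<close> past a \<open>True\<close>, or back to
  \<open>j - 1\<close> with the same \<open>s\<close>, divides the power of the tilt by
  \<open>tilt q\<close> either way. What remains is the sum of the parabola at \<open>j - 1\<close>
  and \<open>j + 1\<close>, which is \<open>2 * (v - 1)\<close>.\<close>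

lemma tile_weight_drift:
  assumes c: "contraction_rate n \<gamma> q" and m: "Suc j < m" "m \<le> n"
  shows "q * tile_weight q m (Suc j) (Suc s) + (if j = 0 then 0 else q * tile_weight q m (j - 1) s)
    \<le> (1 - \<gamma>) * tile_weight q m j s"
proof -
  have q: "1/2 \<le> q" using c by (simp add: contraction_rate_def)
  note t = tilt_bounds[OF q]
  define v where "v = (real j + 1) * (real m - 1 - real j)"
  define c0 where "c0 = tilt q ^ j / (tilt q ^ 2) ^ s"
  have c0: "0 < c0" using t by (simp add: c0_def)
  have v1: "1 \<le> v" unfolding v_def
    using m mult_mono[of 1 "real j + 1" 1 "real m - 1 - real j"] by auto
  \<comment> \<open>Completing the square bounds the parabola by its value in the middle.\<close>
  have "4 * v = real m ^ 2 - (2 * (real j + 1) - real m)^2"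
    by (simp add: v_def power2_eq_square algebra_simps)
  also have "\<dots> \<le> real m ^ 2" by simp
  also have "\<dots> \<le> real n ^ 2" using m by (intro power_mono) auto
  finally have v2: "v \<le> real n ^ 2 / 4" by simp
  have 1: "tile_weight q m (Suc j) (Suc s) = c0 / tilt q * ((real j + 2) * (real m - 2 - real j))"
  proof -
    have "tilt q ^ Suc j / (tilt q ^ 2) ^ Suc s = c0 / tilt q"
      using t by (simp add: c0_def power2_eq_square)
    moreover have "real (Suc j) + 1 = real j + 2" "real m - 1 - real (Suc j) = real m - 2 - real j"
      by auto
    ultimately show ?thesis unfolding tile_weight_def by (simp only: mult.assoc)
  qed
  \<comment> \<open>For \<open>j = 0\<close> the factor \<open>real j\<close> vanishes, in
    accordance with the missing left neighbour.\<close>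
  have 2: "(if j = 0 then 0 else q * tile_weight q m (j - 1) s)
      = q * (c0 / tilt q * (real j * (real m - real j)))"
    using t by (cases j) (simp_all add: tile_weight_def c0_def diff_diff_eq add.commute)
  have 3: "tile_weight q m j s = c0 * v" by (simp add: tile_weight_def c0_def v_def mult.assoc)
  have "q * tile_weight q m (Suc j) (Suc s) + (if j = 0 then 0 else q * tile_weight q m (j - 1) s)
     = c0 * (2 * q / tilt q * (v - 1))"
    unfolding 1 2 v_def using t by (simp add: field_simps)
  also have "\<dots> \<le> c0 * ((1 - \<gamma>) * v)"
    using c v1 v2 c0 unfolding contraction_rate_def by (intro mult_left_mono) auto
  finally show ?thesis by (simp add: 3 mult.left_commute)
qed

lemma tile_weight_Suc_same:
  assumes "1/2 \<le> q" "Suc (Suc j) \<le> m"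
  shows "(1 - q) * tile_weight q m (Suc j) s \<le> q * tile_weight q m (Suc j) (Suc s)"
proof -
  note t = tilt_bounds[OF assms(1)]
  have "(1 - q) * tile_weight q m (Suc j) s \<le> q / tilt q ^ 2 * tile_weight q m (Suc j) s"
    using one_minus_le_tilt tile_weight_nonneg assms by (intro mult_right_mono) auto
  also have "\<dots> = q * tile_weight q m (Suc j) (Suc s)"
    using t by (simp add: tile_weight_def field_simps)
  finally show ?thesis .
qed

section \<open>Contraction along one exchange in a single word\<close>

lemma flip_append:
  "flip q (length us) g (us @ x # y # vs) =
     (if x = y then g (us @ x # y # vs)
      else q * g (us @ True # False # vs) + (1 - q) * g (us @ False # True # vs))"
  by (simp add: flip_def nth_append list_update_append)

lemma split_at_two:
  assumes "Suc k < length xs"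
  obtains us x y vs where "xs = us @ x # y # vs" "length us = k"
proof -
  have "xs = take k xs @ xs ! k # xs ! Suc k # drop (Suc (Suc k)) xs"
    using assms by (metis Cons_nth_drop_Suc Suc_lessD append_take_drop_id)
  then show ?thesis using that assms by force
qed


lemma convex_bound_le_abs:
  fixes x y x' y' c q :: real
  assumes "\<bar>x - x'\<bar> \<le> c" "\<bar>y - y'\<bar> \<le> c" "0 \<le> q" "q \<le> 1"
  shows "\<bar>(q * x + (1 - q) * y) - (q * x' + (1 - q) * y')\<bar> \<le> c"
proof -
  have "(q * x + (1 - q) * y) - (q * x' + (1 - q) * y') = q * (x - x') + (1 - q) * (y - y')"
    by (simp add: algebra_simps)
  also have "\<bar>\<dots>\<bar> \<le> q * \<bar>x - x'\<bar> + (1 - q) * \<bar>y - y'\<bar>"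
    using assms by (intro abs_triangle_ineq[THEN order_trans]) (simp add: abs_mult)
  also have "\<dots> \<le> q * c + (1 - q) * c" using assms by (intro add_mono mult_left_mono) auto
  finally show ?thesis by (simp add: algebra_simps)
qed

text \<open>Position by position, with the exchange at \<open>j\<close>. At \<open>k = j\<close>
  both words have the same average, which saves one full weight. At \<open>k = j + 1\<close> and
  \<open>k = j - 1\<close> exactly one of the two words can move, at a cost of at most
  \<open>q\<close> times a neighbouring weight. At all other \<open>k\<close> the update commutes
  with the exchange and alters neither \<open>j\<close> nor \<open>s\<close>. The saving is balanced
  against the two costs in \<open>tile_weight_drift\<close>.\<close>

lemma sum_flip_contract:
  fixes g :: "bool list \<Rightarrow> real"
  assumes c: "contraction_rate n \<gamma> q" and A: "0 \<le> A" and m: "m \<le> n"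
    and lip: "\<And>us vs. length us + length vs + 2 = m \<Longrightarrow> count_list (us @ vs) True = a \<Longrightarrow>
      \<bar>g (us @ True # False # vs) - g (us @ False # True # vs)\<bar>
        \<le> A * tile_weight q m (length us) (count_list us True)"
    and len: "length us + length vs + 2 = m" "count_list (us @ vs) True = a"
  shows "\<bar>(\<Sum>k<m-1. flip q k g (us @ True # False # vs))
           - (\<Sum>k<m-1. flip q k g (us @ False # True # vs))\<bar>
    \<le> (real (m - 1) - \<gamma>) * (A * tile_weight q m (length us) (count_list us True))"
proof -
  define j where "j = length us"
  define s where "s = count_list us True"
  define W where "W = tile_weight q m"
  let ?b = "us @ True # False # vs" and ?b' = "us @ False # True # vs"
  have q: "1/2 \<le> q" "q \<le> 1" using c by (auto simp: contraction_rate_def)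
  have lip': "\<bar>g (xs @ True # False # ys) - g (xs @ False # True # ys)\<bar>
      \<le> A * W (length xs) (count_list xs True)"
    if "length xs + length ys + 2 = m" "count_list (xs @ ys) True = a" for xs ys
    using lip[OF that] by (simp add: W_def)
  have j: "Suc j < m" using len by (simp add: j_def)
  have W0: "0 \<le> W i r" if "i < m" for i r
    unfolding W_def using tile_weight_nonneg q that by simp
  have base: "\<bar>g ?b - g ?b'\<bar> \<le> A * W j s" unfolding j_def s_def using lip'[OF len] .
  \<comment> \<open>The extra terms are those for a \<open>True\<close> on the right and a
    \<open>False\<close> on the left of the exchange. The opposite letters give \<open>1 - q\<close>
    times a weight larger by \<open>tilt q ^ 2\<close>, which \<open>one_minus_le_tilt\<close>
    covers.\<close>
  define B where "B k = A * (W j s + (if k = j then - W j s else 0)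
      + (if k = Suc j then q * W (Suc j) (Suc s) else 0)
      + (if Suc k = j then q * W (j - 1) s else 0))" for k
  have bound: "\<bar>flip q k g ?b - flip q k g ?b'\<bar> \<le> B k" if k: "k < m - 1" for k
  proof -
    consider "k = j" | "k = Suc j" | "Suc k = j" | "Suc k < j" | "Suc j < k" by linarith
    then show ?thesis
    proof cases
      case 1
      then have "flip q k g ?b = flip q k g ?b'" by (simp add: j_def flip_append)
      then show ?thesis using 1 by (simp add: B_def)
    next
      case 2
      then obtain y vs' where vs: "vs = y # vs'" using k len by (cases vs) (auto simp: j_def)
      have k': "k = length (us @ [x])" for x using 2 by (simp add: j_def)
      have Bk: "B k = A * W j s + A * (q * W (Suc j) (Suc s))" using 2 by (simp add: B_def algebra_simps)
      have f1: "flip q k g ?b = (if y then q * g ((us @ [True]) @ True # False # vs') + (1 - q) * g ?b else g ?b)"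
        using flip_append[of q "us @ [True]" g False y vs'] by (auto simp: k'[of True] vs)
      have f2: "flip q k g ?b' = (if y then g ?b' else q * g ?b' + (1 - q) * g ((us @ [False]) @ False # True # vs'))"
        using flip_append[of q "us @ [False]" g True y vs'] by (auto simp: k'[of False] vs)
      show ?thesis
      proof (cases y)
        case True
        have l: "\<bar>g ((us @ [True]) @ True # False # vs') - g ?b\<bar> \<le> A * W (Suc j) (Suc s)"
          using lip'[of "us @ [True]" vs'] len True by (simp add: vs j_def s_def)
        have "flip q k g ?b - flip q k g ?b' =
          (g ?b - g ?b') + q * (g ((us @ [True]) @ True # False # vs') - g ?b)"
          using True by (simp add: f1 f2 algebra_simps)
        also have "\<bar>\<dots>\<bar> \<le> \<bar>g ?b - g ?b'\<bar> + q * \<bar>g ((us @ [True]) @ True # False # vs') - g ?b\<bar>"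
          using q by (intro abs_triangle_ineq[THEN order_trans]) (simp add: abs_mult)
        also have "\<dots> \<le> A * W j s + q * (A * W (Suc j) (Suc s))"
          using base l q by (intro add_mono mult_left_mono) auto
        finally show ?thesis by (simp add: Bk mult.left_commute)
      next
        case False
        have l: "\<bar>g ?b' - g ((us @ [False]) @ False # True # vs')\<bar> \<le> A * W (Suc j) s"
          using lip'[of "us @ [False]" vs'] len False by (simp add: vs j_def s_def)
        have "flip q k g ?b - flip q k g ?b' =
          (g ?b - g ?b') + (1 - q) * (g ?b' - g ((us @ [False]) @ False # True # vs'))"
          using False by (simp add: f1 f2 algebra_simps)
        also have "\<bar>\<dots>\<bar> \<le> \<bar>g ?b - g ?b'\<bar> + (1 - q) * \<bar>g ?b' - g ((us @ [False]) @ False # True # vs')\<bar>"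
          using q by (intro abs_triangle_ineq[THEN order_trans]) (simp add: abs_mult)
        also have "\<dots> \<le> A * W j s + (1 - q) * (A * W (Suc j) s)"
          using base l q by (intro add_mono mult_left_mono) auto
        also have "\<dots> \<le> A * W j s + A * (q * W (Suc j) (Suc s))"
          using mult_left_mono[OF tile_weight_Suc_same[of q j m s] A] q j
          by (simp add: W_def mult.left_commute)
        finally show ?thesis by (simp add: Bk)
      qed
    next
      case 3
      then obtain us' x where us: "us = us' @ [x]" by (cases us rule: rev_exhaust) (auto simp: j_def)
      have k': "k = length us'" using 3 by (simp add: j_def us)
      have Bk: "B k = A * W j s + A * (q * W (j - 1) s)" using 3 by (auto simp: B_def algebra_simps)
      have f1: "flip q k g ?b = (if x then g ?b else q * g (us' @ True # False # False # vs) + (1 - q) * g ?b)"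
        using flip_append[of q us' g x True "False # vs"] by (auto simp: k' us)
      have f2: "flip q k g ?b' = (if x then q * g ?b' + (1 - q) * g (us' @ False # True # True # vs) else g ?b')"
        using flip_append[of q us' g x False "True # vs"] by (auto simp: k' us)
      show ?thesis
      proof (cases x)
        case True
        have l: "\<bar>g ?b' - g (us' @ False # True # True # vs)\<bar> \<le> A * W (j - 1) (s - 1)"
          using lip'[of us' "True # vs"] len True by (simp add: us j_def s_def)
        have s1: "(1 - q) * W (j - 1) (s - 1) \<le> q * W (j - 1) s"
        proof -
          have "(1 - q) * W (j - 1) (s - 1) \<le> q / tilt q ^ 2 * W (j - 1) (s - 1)"
            using one_minus_le_tilt[OF q(1)] W0 j by (intro mult_right_mono) auto
          also have "\<dots> = q * W (j - 1) (Suc (s - 1))"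
            using tilt_bounds[OF q(1)] by (simp add: W_def tile_weight_def field_simps)
          also have "Suc (s - 1) = s" using True by (simp add: us s_def)
          finally show ?thesis .
        qed
        have "flip q k g ?b - flip q k g ?b' =
          (g ?b - g ?b') + (1 - q) * (g ?b' - g (us' @ False # True # True # vs))"
          using True by (simp add: f1 f2 algebra_simps)
        also have "\<bar>\<dots>\<bar> \<le> \<bar>g ?b - g ?b'\<bar> + (1 - q) * \<bar>g ?b' - g (us' @ False # True # True # vs)\<bar>"
          using q by (intro abs_triangle_ineq[THEN order_trans]) (simp add: abs_mult)
        also have "\<dots> \<le> A * W j s + (1 - q) * (A * W (j - 1) (s - 1))"
          using base l q by (intro add_mono mult_left_mono) auto
        also have "\<dots> \<le> A * W j s + A * (q * W (j - 1) s)"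
          using mult_left_mono[OF s1 A] by (simp add: mult.left_commute)
        finally show ?thesis by (simp add: Bk)
      next
        case False
        have l: "\<bar>g (us' @ True # False # False # vs) - g ?b\<bar> \<le> A * W (j - 1) s"
          using lip'[of us' "False # vs"] len False by (simp add: us j_def s_def)
        have "flip q k g ?b - flip q k g ?b' =
          (g ?b - g ?b') + q * (g (us' @ True # False # False # vs) - g ?b)"
          using False by (simp add: f1 f2 algebra_simps)
        also have "\<bar>\<dots>\<bar> \<le> \<bar>g ?b - g ?b'\<bar> + q * \<bar>g (us' @ True # False # False # vs) - g ?b\<bar>"
          using q by (intro abs_triangle_ineq[THEN order_trans]) (simp add: abs_mult)
        also have "\<dots> \<le> A * W j s + q * (A * W (j - 1) s)"
          using base l q by (intro add_mono mult_left_mono) auto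
        finally show ?thesis by (simp add: Bk mult.left_commute)
      qed
    next
      case 4
      then have "Suc k < length us" by (simp add: j_def)
      then obtain u1 x y u2 where us: "us = u1 @ x # y # u2" and k': "length u1 = k"
        by (rule split_at_two)
      have Bk: "B k = A * W j s" using 4 by (simp add: B_def)
      have l: "\<bar>g ((u1 @ x' # y' # u2) @ True # False # vs) - g ((u1 @ x' # y' # u2) @ False # True # vs)\<bar>
          \<le> A * W j s" if "x' \<noteq> y'" "x \<noteq> y" for x' y'
        using lip'[of "u1 @ x' # y' # u2" vs] len that by (cases x'; cases x) (auto simp: us j_def s_def)
      have f: "flip q k g (us @ z) = (if x = y then g (us @ z)
          else q * g ((u1 @ True # False # u2) @ z) + (1 - q) * g ((u1 @ False # True # u2) @ z))" for z
        using flip_append[of q u1 g x y "u2 @ z"] by (simp add: k' us)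
      show ?thesis
        unfolding f Bk using base convex_bound_le_abs[OF l[of True False] l[of False True]] q
        by (cases "x = y") auto
    next
      case 5
      then have "Suc (k - j - 2) < length vs" using k len by (simp add: j_def)
      then obtain v1 x y v2 where vs: "vs = v1 @ x # y # v2" and k': "length v1 = k - j - 2"
        by (rule split_at_two)
      have Bk: "B k = A * W j s" using 5 by (simp add: B_def)
      have l: "\<bar>g (us @ True # False # v1 @ x' # y' # v2) - g (us @ False # True # v1 @ x' # y' # v2)\<bar>
          \<le> A * W j s" if "x' \<noteq> y'" "x \<noteq> y" for x' y'
        using lip'[of us "v1 @ x' # y' # v2"] len that by (cases x'; cases x) (auto simp: vs j_def s_def)
      have k2: "k = length (us @ z # z' # v1)" for z z' using 5 k' by (simp add: j_def)
      have f: "flip q k g (us @ z # z' # vs) = (if x = y then g (us @ z # z' # vs)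
          else q * g (us @ z # z' # v1 @ True # False # v2) + (1 - q) * g (us @ z # z' # v1 @ False # True # v2))" for z z'
        using flip_append[of q "us @ z # z' # v1" g x y v2] by (simp add: k2[of z z'] vs)
      show ?thesis
        unfolding f Bk using base convex_bound_le_abs[OF l[of True False] l[of False True]] q
        by (cases "x = y") auto
    qed
  qed
  have "\<bar>(\<Sum>k<m-1. flip q k g ?b) - (\<Sum>k<m-1. flip q k g ?b')\<bar> \<le> (\<Sum>k<m-1. B k)"
    unfolding sum_subtractf[symmetric] using bound by (intro order_trans[OF sum_abs] sum_mono) auto
  also have "\<dots> = A * (real (m - 1) * W j s - W j s
      + (if Suc j < m - 1 then q * W (Suc j) (Suc s) else 0)
      + (\<Sum>k<m-1. if Suc k = j then q * W (j - 1) s else 0))"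
    using j unfolding B_def sum_distrib_left[symmetric] by (simp add: sum.distrib sum.delta)
  also have "(\<Sum>k<m-1. if Suc k = j then q * W (j - 1) s else 0)
      = (if j = 0 then 0 else q * W (j - 1) s)"
    using j by (cases j) (auto simp: sum.delta)
  \<comment> \<open>Adding the right neighbour where it is out of range only adds a nonnegative
    term.\<close>
  also have "A * (real (m - 1) * W j s - W j s
      + (if Suc j < m - 1 then q * W (Suc j) (Suc s) else 0) + (if j = 0 then 0 else q * W (j - 1) s))
    \<le> A * (real (m - 1) * W j s - W j s
      + q * W (Suc j) (Suc s) + (if j = 0 then 0 else q * W (j - 1) s))"
    using W0[of "Suc j" "Suc s"] j q A by (intro mult_left_mono add_mono) auto
  also have "\<dots> \<le> A * (real (m - 1) * W j s - W j s + (1 - \<gamma>) * W j s)"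
    using tile_weight_drift[OF c j m, of s] A unfolding W_def[symmetric]
    by (intro mult_left_mono) auto
  also have "\<dots> = (real (m - 1) - \<gamma>) * (A * W j s)"
    by (simp add: algebra_simps)
  finally show ?thesis by (simp add: W_def j_def s_def)
qed

section \<open>Decomposition of the chain along the tree\<close>

lemma pos_append:
  assumes "distinct (xs @ c # ys)"
  shows "pos (xs @ c # ys) c = length xs"
  unfolding pos_def
proof (rule the_equality)
  fix k assume "k < length (xs @ c # ys) \<and> (xs @ c # ys) ! k = c"
  then show "k = length xs"
    using nth_eq_iff_index_eq[OF assms, of k "length xs"] by simp
qed simp

lemma pos_append2:
  assumes "distinct (xs @ c # ys @ d # zs)"
  shows "pos (xs @ c # ys @ d # zs) c = length xs"
    "pos (xs @ c # ys @ d # zs) d = length xs + 1 + length ys"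
  using pos_append[of xs c "ys @ d # zs"] pos_append[of "xs @ c # ys" d zs] assms by auto

lemma between_append:
  assumes "distinct (xs @ c # ys @ d # zs)"
  shows "between (xs @ c # ys @ d # zs) c d = set ys" "between (xs @ c # ys @ d # zs) d c = set ys"
proof -
  have "{(xs @ c # ys @ d # zs) ! k | k. length xs < k \<and> k < length xs + 1 + length ys} = set ys"
    (is "?L = _")
  proof (intro equalityI subsetI)
    fix x assume "x \<in> ?L"
    then obtain k where k: "x = (xs @ c # ys @ d # zs) ! k" "length xs < k" "k < length xs + 1 + length ys"
      by blast
    then have "x = ys ! (k - length xs - 1)" by (auto simp: nth_append nth_Cons')
    then show "x \<in> set ys" using k by auto
  next
    fix x assume "x \<in> set ys"
    then obtain i where "i < length ys" "x = ys ! i" by (auto simp: in_set_conv_nth)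
    then show "x \<in> ?L"
      by (auto intro!: exI[of _ "length xs + 1 + i"] simp: nth_append)
  qed
  then show "between (xs @ c # ys @ d # zs) c d = set ys" "between (xs @ c # ys @ d # zs) d c = set ys"
    unfolding between_def pos_append2[OF assms] by (simp_all add: min_def max_def)
qed

lemma place_append:
  assumes "distinct (xs @ c # ys @ d # zs)"
  shows "place (xs @ c # ys @ d # zs) c d = xs @ c # ys @ d # zs"
    "place (xs @ c # ys @ d # zs) d c = xs @ d # ys @ c # zs"
  unfolding place_def pos_append2[OF assms]
  by (simp_all add: list_update_append min_def max_def)

lemma split_list_two:
  assumes "a \<in> set \<sigma>" "b \<in> set \<sigma>" "a \<noteq> b"
  obtains xs c ys d zs where "\<sigma> = xs @ c # ys @ d # zs" "(c = a \<and> d = b) \<or> (c = b \<and> d = a)"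
proof -
  obtain us vs where s: "\<sigma> = us @ a # vs" using split_list[OF assms(1)] by blast
  then consider "b \<in> set us" | "b \<in> set vs" using assms by auto
  then show thesis
  proof cases
    case 1
    then obtain u1 u2 where "us = u1 @ b # u2" by (meson split_list)
    then show thesis using that[of u1 b u2 a vs] s by simp
  next
    case 2
    then obtain u1 u2 where "vs = u1 @ b # u2" by (meson split_list)
    then show thesis using that[of us a u1 b u2] s by simp
  qed
qed

lemma place_set:
  assumes "distinct \<sigma>" "a \<in> set \<sigma>" "b \<in> set \<sigma>" "a \<noteq> b"
  shows "distinct (place \<sigma> a b)" "set (place \<sigma> a b) = set \<sigma>"
proof -
  obtain xs c ys d zs where s: "\<sigma> = xs @ c # ys @ d # zs" "(c = a \<and> d = b) \<or> (c = b \<and> d = a)"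
    using split_list_two assms by metis
  show "distinct (place \<sigma> a b)" "set (place \<sigma> a b) = set \<sigma>"
    using s(2) place_append[of xs c ys d zs] assms(1) unfolding s(1) by auto
qed

lemma place_in_permutations:
  assumes "\<sigma> \<in> permutations_of_set S" "a \<in> S" "b \<in> S" "a \<noteq> b"
  shows "place \<sigma> a b \<in> permutations_of_set S"
  using place_set[of \<sigma> a b] assms by (auto simp: permutations_of_set_def)

text \<open>Applied with \<open>h\<close> the membership in the left subtree: a move on two leaves
  of the same side keeps the word at the node.\<close>

lemma place_map:
  assumes "distinct \<sigma>" "a \<in> set \<sigma>" "b \<in> set \<sigma>" "a \<noteq> b" "h a = h b"
  shows "map h (place \<sigma> a b) = map h \<sigma>"
proof -
  obtain xs c ys d zs where s: "\<sigma> = xs @ c # ys @ d # zs" "(c = a \<and> d = b) \<or> (c = b \<and> d = a)"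
    using split_list_two assms by metis
  show ?thesis
    using s(2) place_append[of xs c ys d zs] assms(1,5) unfolding s(1) by auto
qed

text \<open>A move inside one subtree acts there as the same move on the restricted list and is
  invisible on the other side. With \<open>place_map\<close> this makes the words of the nodes the
  coordinates of a product.\<close>

lemma place_filter:
  assumes "distinct \<sigma>" "a \<in> set \<sigma>" "b \<in> set \<sigma>" "a \<noteq> b" "P a" "P b"
  shows "filter P (place \<sigma> a b) = place (filter P \<sigma>) a b"
    and "filter (\<lambda>x. \<not> P x) (place \<sigma> a b) = filter (\<lambda>x. \<not> P x) \<sigma>"
    and "between (filter P \<sigma>) a b = between \<sigma> a b \<inter> Collect P"
proof -
  obtain xs c ys d zs where s: "\<sigma> = xs @ c # ys @ d # zs" and cd: "(c = a \<and> d = b) \<or> (c = b \<and> d = a)"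
    using split_list_two assms by metis
  have P: "P c" "P d" using cd assms by auto
  have f: "filter P \<sigma> = filter P xs @ c # filter P ys @ d # filter P zs" by (simp add: s P)
  have d: "distinct (xs @ c # ys @ d # zs)" using assms(1) by (simp add: s)
  have d': "distinct (filter P xs @ c # filter P ys @ d # filter P zs)"
    using assms(1) distinct_filter[of \<sigma> P] by (simp only: f)
  have pl: "place \<sigma> a b = xs @ a # ys @ b # zs" "between \<sigma> a b = set ys"
    unfolding s using cd place_append[OF d] between_append[OF d] by auto
  have plf: "place (filter P \<sigma>) a b = filter P xs @ a # filter P ys @ b # filter P zs"
      "between (filter P \<sigma>) a b = set (filter P ys)"
    unfolding f using cd place_append[OF d'] between_append[OF d'] by auto
  show "filter P (place \<sigma> a b) = place (filter P \<sigma>) a b"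
    "between (filter P \<sigma>) a b = between \<sigma> a b \<inter> Collect P"
    using assms(5,6) by (auto simp: pl plf)
  show "filter (\<lambda>x. \<not> P x) (place \<sigma> a b) = filter (\<lambda>x. \<not> P x) \<sigma>"
    using assms(5,6) P by (simp add: pl(1)) (simp add: s)
qed

text \<open>The inverse of splitting a list into the word of a predicate and two sublists. It
  matters for words with as many \<open>True\<close> as \<open>xs\<close> has entries and as many
  \<open>False\<close> as \<open>ys\<close>, so that no \<open>hd\<close> meets an empty list and
  nothing is left over.\<close>

fun shuffle_by :: "bool list \<Rightarrow> 'a list \<Rightarrow> 'a list \<Rightarrow> 'a list" where
  "shuffle_by [] xs ys = []"
| "shuffle_by (True # w) xs ys = hd xs # shuffle_by w (tl xs) ys"
| "shuffle_by (False # w) xs ys = hd ys # shuffle_by w xs (tl ys)"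

lemma shuffle_by_filter:
  "shuffle_by (map P xs) (filter P xs) (filter (\<lambda>x. \<not> P x) xs) = xs"
proof (induction xs)
  case (Cons x xs)
  then show ?case by (cases "P x") auto
qed simp

lemma shuffle_by_inverse:
  assumes "length xs = count_list w True" "length ys = count_list w False"
    "\<forall>x\<in>set xs. P x" "\<forall>y\<in>set ys. \<not> P y"
  shows "map P (shuffle_by w xs ys) = w" "filter P (shuffle_by w xs ys) = xs"
    "filter (\<lambda>x. \<not> P x) (shuffle_by w xs ys) = ys"
    "mset (shuffle_by w xs ys) = mset xs + mset ys"
proof -
  have "map P (shuffle_by w xs ys) = w \<and> filter P (shuffle_by w xs ys) = xs \<and>
    filter (\<lambda>x. \<not> P x) (shuffle_by w xs ys) = ys \<and> mset (shuffle_by w xs ys) = mset xs + mset ys"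
    using assms
  proof (induction w xs ys rule: shuffle_by.induct)
    case (2 w xs ys)
    then show ?case by (cases xs) auto
  next
    case (3 w xs ys)
    then show ?case by (cases ys) auto
  qed auto
  then show "map P (shuffle_by w xs ys) = w" "filter P (shuffle_by w xs ys) = xs"
    "filter (\<lambda>x. \<not> P x) (shuffle_by w xs ys) = ys"
    "mset (shuffle_by w xs ys) = mset xs + mset ys" by auto
qed

section \<open>The transition operator and its splitting at the root\<close>

abbreviation tree_perms :: "ltree \<Rightarrow> nat list set" where
  "tree_perms T \<equiv> permutations_of_set (set (leaves T))"

definition leaf_pairs :: "ltree \<Rightarrow> (nat \<times> nat) set" where
  "leaf_pairs T = {(a, b). a \<in> set (leaves T) \<and> b \<in> set (leaves T) \<and> a < b}"

text \<open>The mean of \<open>f\<close> after a move on a given pair. The bias is read off the tree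
  instead of \<open>p\<close>, which lets the operator restrict to subtrees;
  \<open>league_structure\<close> identifies the two in
  \<open>expectation_tree_step\<close>.\<close>

definition pair_update :: "ltree \<Rightarrow> (nat list \<Rightarrow> real) \<Rightarrow> nat list \<Rightarrow> nat \<Rightarrow> nat \<Rightarrow> real" where
  "pair_update T f \<sigma> a b =
     (if between \<sigma> a b \<inter> set (leaves (lca T a b)) = {}
      then root_label (lca T a b) * f (place \<sigma> a b) + (1 - root_label (lca T a b)) * f (place \<sigma> b a)
      else f \<sigma>)"

text \<open>The transition operator of the chain, scaled by the number of pairs.\<close>

definition tree_op :: "ltree \<Rightarrow> (nat list \<Rightarrow> real) \<Rightarrow> nat list \<Rightarrow> real" where
  "tree_op T f \<sigma> = (\<Sum>(a, b)\<in>leaf_pairs T. pair_update T f \<sigma> a b)"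

definition words :: "nat \<Rightarrow> nat \<Rightarrow> bool list set" where
  "words a b = {w. count_list w True = a \<and> count_list w False = b}"

lemma length_words: "w \<in> words a b \<Longrightarrow> length w = a + b"
proof -
  have "length w = count_list w True + count_list w False" by (induction w) auto
  then show "w \<in> words a b \<Longrightarrow> length w = a + b" by (simp add: words_def)
qed

lemma finite_leaf_pairs [simp]: "finite (leaf_pairs T)"
  by (rule finite_subset[of _ "set (leaves T) \<times> set (leaves T)"]) (auto simp: leaf_pairs_def)

lemma lca_mem:
  assumes "(a, b) \<in> leaf_pairs T" "distinct (leaves T)"
  shows "root_label (lca T a b) \<in> node_labels T" "set (leaves (lca T a b)) \<subseteq> set (leaves T)"
proof -
  have "root_label (lca T a b) \<in> node_labels T \<and> set (leaves (lca T a b)) \<subseteq> set (leaves T)"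
    using assms by (induction T) (auto simp: leaf_pairs_def)
  then show "root_label (lca T a b) \<in> node_labels T" "set (leaves (lca T a b)) \<subseteq> set (leaves T)"
    by auto
qed

text \<open>Of the \<open>a * b\<close> pairs of leaves meeting at a node only the adjacent ones, at most
  \<open>a + b - 1\<close> in number, can move; the others contribute an idle step.\<close>

definition word_op :: "real \<Rightarrow> nat \<Rightarrow> nat \<Rightarrow> (bool list \<Rightarrow> real) \<Rightarrow> bool list \<Rightarrow> real" where
  "word_op q a b g w =
     (real (a * b) - real (a + b - 1)) * g w + (\<Sum>k<a + b - 1. flip q k g w)"

text \<open>Compare deviations from the idle value \<open>f \<sigma>\<close>. A cross pair with
  nothing in between occupies positions \<open>k\<close>, \<open>k + 1\<close> with different
  letters, and each such \<open>k\<close> comes from exactly one pair. Positions with equal letters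
  have deviation zero, which extends the sum to all \<open>k\<close>.\<close>

lemma sum_cross_pairs:
  fixes f :: "nat list \<Rightarrow> real"
  assumes \<sigma>: "distinct \<sigma>" "set \<sigma> = A \<union> B" and AB: "A \<inter> B = {}"
    and w: "w = map (\<lambda>x. x \<in> A) \<sigma>"
    and s: "s = filter (\<lambda>x. x \<in> A) \<sigma>" and t: "t = filter (\<lambda>x. x \<notin> A) \<sigma>"
  shows "(\<Sum>(a, b)\<in>A \<times> B. if between \<sigma> a b = {}
            then q * f (place \<sigma> a b) + (1 - q) * f (place \<sigma> b a) else f \<sigma>)
       = word_op q (card A) (card B) (\<lambda>w'. f (shuffle_by w' s t)) w"
proof -
  define g where "g w' = f (shuffle_by w' s t)" for w'
  define u where "u = (\<lambda>(a, b). q * f (place \<sigma> a b) + (1 - q) * f (place \<sigma> b a) - f \<sigma>)"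
  define X where "X = {(a, b). (a, b) \<in> A \<times> B \<and> between \<sigma> a b = {}}"
  define Y where "Y = {k. Suc k < length \<sigma> \<and> w ! k \<noteq> w ! Suc k}"
  have fin: "finite A" "finite B" using \<sigma>(2) finite_set[of \<sigma>] by (simp_all add: finite_Un)
  have card: "card A + card B = length \<sigma>"
    using \<sigma> AB fin by (metis card_Un_disjoint distinct_card)
  have g_w: "g w = f \<sigma>" unfolding g_def w s t by (simp add: shuffle_by_filter)
  \<comment> \<open>The exchanged entries belong to different sides, so both sublists stay
    \<open>s\<close> and \<open>t\<close> and only the word changes.\<close>
  have g_swap: "g (map (\<lambda>x. x \<in> A) xs @ True # False # map (\<lambda>x. x \<in> A) zs) = f (xs @ a # b # zs)"
      "g (map (\<lambda>x. x \<in> A) xs @ False # True # map (\<lambda>x. x \<in> A) zs) = f (xs @ b # a # zs)"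
    if "\<sigma> = xs @ c # d # zs" "(c = a \<and> d = b) \<or> (c = b \<and> d = a)" "a \<in> A" "b \<notin> A" for xs c d zs a b
    using that shuffle_by_filter[of "\<lambda>x. x \<in> A" "xs @ a # b # zs"]
      shuffle_by_filter[of "\<lambda>x. x \<in> A" "xs @ b # a # zs"]
    unfolding g_def s t by auto
  have "(\<Sum>x\<in>X. u x) = (\<Sum>k\<in>Y. flip q k g w - g w)"
  proof (rule sum.reindex_bij_witness
      [where i = "\<lambda>k. if w ! k then (\<sigma> ! k, \<sigma> ! Suc k) else (\<sigma> ! Suc k, \<sigma> ! k)"
         and j = "\<lambda>(a, b). min (pos \<sigma> a) (pos \<sigma> b)"])
    fix x assume "x \<in> X"
    then obtain a b where x: "x = (a, b)" "a \<in> A" "b \<in> B" "between \<sigma> a b = {}" by (auto simp: X_def)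
    have b: "b \<notin> A" "a \<noteq> b" using x AB by auto
    have "a \<in> set \<sigma>" "b \<in> set \<sigma>" using x \<sigma> by auto
    from split_list_two[OF this b(2)] obtain xs c ys d zs where dec: "\<sigma> = xs @ c # ys @ d # zs"
      and cd: "(c = a \<and> d = b) \<or> (c = b \<and> d = a)"
      by metis
    have "ys = []" using x(4) cd between_append[of xs c ys d zs] \<sigma>(1) by (auto simp: dec)
    then have dec: "\<sigma> = xs @ c # d # zs" using dec by simp
    have dd: "distinct (xs @ c # [] @ d # zs)" using \<sigma>(1) dec by simp
    have j: "min (pos \<sigma> a) (pos \<sigma> b) = length xs"
      using cd pos_append2[OF dd] by (auto simp: dec)
    have wd: "w = map (\<lambda>x. x \<in> A) xs @ (c \<in> A) # (d \<in> A) # map (\<lambda>x. x \<in> A) zs"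
      by (simp add: w dec)
    have neq: "(c \<in> A) \<noteq> (d \<in> A)" using cd x b by auto
    have wk: "w ! length xs = (c \<in> A)" "w ! Suc (length xs) = (d \<in> A)"
      by (simp_all add: wd nth_append)
    show "(if w ! (case x of (a, b) \<Rightarrow> min (pos \<sigma> a) (pos \<sigma> b))
            then (\<sigma> ! (case x of (a, b) \<Rightarrow> min (pos \<sigma> a) (pos \<sigma> b)),
                  \<sigma> ! Suc (case x of (a, b) \<Rightarrow> min (pos \<sigma> a) (pos \<sigma> b)))
            else (\<sigma> ! Suc (case x of (a, b) \<Rightarrow> min (pos \<sigma> a) (pos \<sigma> b)),
                  \<sigma> ! (case x of (a, b) \<Rightarrow> min (pos \<sigma> a) (pos \<sigma> b)))) = x"
      using cd x b unfolding x(1) by (auto simp: j wk) (auto simp: dec nth_append)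
    show "(case x of (a, b) \<Rightarrow> min (pos \<sigma> a) (pos \<sigma> b)) \<in> Y"
      unfolding x(1) using neq by (auto simp: j Y_def wk) (auto simp: dec)
    have pl: "place \<sigma> a b = xs @ a # b # zs" "place \<sigma> b a = xs @ b # a # zs"
      using cd place_append[OF dd] by (auto simp: dec)
    have "flip q (length xs) g w = q * f (xs @ a # b # zs) + (1 - q) * f (xs @ b # a # zs)"
      using flip_append[of q "map (\<lambda>x. x \<in> A) xs" g "c \<in> A" "d \<in> A" "map (\<lambda>x. x \<in> A) zs"] neq
        g_swap[OF dec cd x(2) b(1)] by (simp add: wd)
    then show "flip q (case x of (a, b) \<Rightarrow> min (pos \<sigma> a) (pos \<sigma> b)) g w - g w = u x"
      unfolding x(1) by (simp add: j u_def pl g_w)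
  next
    fix k assume "k \<in> Y"
    then have k: "Suc k < length \<sigma>" "w ! k \<noteq> w ! Suc k" by (auto simp: Y_def)
    obtain xs c d zs where dec: "\<sigma> = xs @ c # d # zs" and len: "length xs = k"
      using k(1) by (rule split_at_two)
    have wk: "w ! k = (c \<in> A)" "w ! Suc k = (d \<in> A)"
      by (simp_all add: w dec len[symmetric] nth_append)
    have sk: "\<sigma> ! k = c" "\<sigma> ! Suc k = d"
      by (simp_all add: dec len[symmetric] nth_append)
    have dd: "distinct (xs @ c # [] @ d # zs)" using \<sigma>(1) dec by simp
    have cd: "c \<in> A \<union> B" "d \<in> A \<union> B" using \<sigma>(2) by (auto simp: dec)
    have ps: "pos \<sigma> c = k" "pos \<sigma> d = Suc k" using pos_append2[OF dd] by (simp_all add: dec len)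
    have bt: "between \<sigma> c d = {}" "between \<sigma> d c = {}" using between_append[OF dd] by (simp_all add: dec)
    show "(case if w ! k then (\<sigma> ! k, \<sigma> ! Suc k) else (\<sigma> ! Suc k, \<sigma> ! k) of
        (a, b) \<Rightarrow> min (pos \<sigma> a) (pos \<sigma> b)) = k"
      by (simp add: sk ps)
    show "(if w ! k then (\<sigma> ! k, \<sigma> ! Suc k) else (\<sigma> ! Suc k, \<sigma> ! k)) \<in> X"
      using k(2) cd AB bt by (auto simp: wk sk X_def)
  qed
  also have "(\<Sum>k\<in>Y. flip q k g w - g w) = (\<Sum>k<length \<sigma> - 1. flip q k g w - g w)"
    by (rule sum.mono_neutral_left) (auto simp: Y_def flip_def)
  finally have 1: "(\<Sum>x\<in>X. u x) = (\<Sum>k<length \<sigma> - 1. flip q k g w) - real (length \<sigma> - 1) * g w"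
    by (simp add: sum_subtractf)
  have "(\<Sum>(a, b)\<in>A \<times> B. if between \<sigma> a b = {}
            then q * f (place \<sigma> a b) + (1 - q) * f (place \<sigma> b a) else f \<sigma>)
      = (\<Sum>x\<in>A \<times> B. (if x \<in> X then u x else 0) + f \<sigma>)"
    by (intro sum.cong refl) (clarsimp simp: X_def u_def)
  also have "\<dots> = (\<Sum>x\<in>X. u x) + real (card A * card B) * f \<sigma>"
  proof -
    have "X \<subseteq> A \<times> B" by (auto simp: X_def)
    then have "(\<Sum>x\<in>A \<times> B. if x \<in> X then u x else 0) = (\<Sum>x\<in>X. u x)"
      using fin by (simp add: sum.If_cases Int_absorb1)
    then show ?thesis by (simp add: sum.distrib card_cartesian_product)
  qed
  finally show ?thesis
    unfolding 1 word_op_def card g_def[symmetric] g_w[symmetric] by (simp add: algebra_simps)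
qed

lemma tree_perms_shuffle:
  assumes "distinct (leaves (Node q l r))"
    and "w \<in> words (length (leaves l)) (length (leaves r))" "s \<in> tree_perms l" "t \<in> tree_perms r"
  shows "shuffle_by w s t \<in> tree_perms (Node q l r)"
    "map (\<lambda>x. x \<in> set (leaves l)) (shuffle_by w s t) = w"
    "filter (\<lambda>x. x \<in> set (leaves l)) (shuffle_by w s t) = s"
    "filter (\<lambda>x. x \<notin> set (leaves l)) (shuffle_by w s t) = t"
proof -
  have s: "distinct s" "set s = set (leaves l)" "distinct t" "set t = set (leaves r)"
    using assms by (auto simp: permutations_of_set_def)
  have len: "length s = count_list w True" "length t = count_list w False"
    using s assms distinct_card[of s] distinct_card[of t] distinct_card[of "leaves l"]
      distinct_card[of "leaves r"] by (auto simp: words_def)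
  have dis: "\<forall>x\<in>set s. x \<in> set (leaves l)" "\<forall>x\<in>set t. x \<notin> set (leaves l)"
    using s assms(1) by auto
  note inv = shuffle_by_inverse[OF len, of "\<lambda>x. x \<in> set (leaves l)", OF dis]
  show "map (\<lambda>x. x \<in> set (leaves l)) (shuffle_by w s t) = w"
    "filter (\<lambda>x. x \<in> set (leaves l)) (shuffle_by w s t) = s"
    "filter (\<lambda>x. x \<notin> set (leaves l)) (shuffle_by w s t) = t"
    using inv by auto
  have m: "mset (shuffle_by w s t) = mset (s @ t)" using inv(4) by simp
  have "distinct (s @ t)" using s assms(1) by auto
  then have "distinct (shuffle_by w s t)" using m by (metis mset_eq_imp_distinct_iff)
  moreover have "set (shuffle_by w s t) = set (s @ t)" using m by (metis set_mset_mset)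
  ultimately show "shuffle_by w s t \<in> tree_perms (Node q l r)"
    using s by (auto simp: permutations_of_set_def)
qed

lemma tree_perms_obtain_shuffle:
  assumes "distinct (leaves (Node q l r))" "\<sigma> \<in> tree_perms (Node q l r)"
  obtains w s t where "w \<in> words (length (leaves l)) (length (leaves r))"
    "s \<in> tree_perms l" "t \<in> tree_perms r" "\<sigma> = shuffle_by w s t"
proof -
  let ?P = "\<lambda>x. x \<in> set (leaves l)"
  have \<sigma>: "distinct \<sigma>" "set \<sigma> = set (leaves l) \<union> set (leaves r)"
    using assms(2) by (auto simp: permutations_of_set_def)
  have 1: "filter ?P \<sigma> \<in> tree_perms l" "filter (\<lambda>x. \<not> ?P x) \<sigma> \<in> tree_perms r"
    using \<sigma> assms(1) by (auto simp: permutations_of_set_def)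
  have "count_list (map ?P \<sigma>) True = length (filter ?P \<sigma>)"
    "count_list (map ?P \<sigma>) False = length (filter (\<lambda>x. \<not> ?P x) \<sigma>)"
    by (induction \<sigma>) auto
  moreover have "length (filter ?P \<sigma>) = length (leaves l)"
    "length (filter (\<lambda>x. \<not> ?P x) \<sigma>) = length (leaves r)"
    using 1 assms(1) by (simp_all add: permutations_of_set_def distinct_card[symmetric])
  ultimately have "map ?P \<sigma> \<in> words (length (leaves l)) (length (leaves r))"
    by (simp add: words_def)
  then show thesis using that[OF _ 1] shuffle_by_filter[of ?P \<sigma>] by simp
qed

text \<open>As the leaves increase from left to right, a pair meeting at the root has its smaller
  element on the left, so the cross pairs form a full product.\<close>

lemma leaf_pairs_Node:
  assumes "sorted_wrt (<) (leaves (Node q l r))"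
  shows "leaf_pairs (Node q l r) = leaf_pairs l \<union> (leaf_pairs r \<union> set (leaves l) \<times> set (leaves r))"
    "leaf_pairs l \<inter> (leaf_pairs r \<union> set (leaves l) \<times> set (leaves r)) = {}"
    "leaf_pairs r \<inter> set (leaves l) \<times> set (leaves r) = {}"
  using assms by (fastforce simp: leaf_pairs_def sorted_wrt_append)+

lemma card_leaf_pairs_Node:
  assumes "sorted_wrt (<) (leaves (Node q l r))"
  shows "card (leaf_pairs (Node q l r))
    = card (leaf_pairs l) + card (leaf_pairs r) + length (leaves l) * length (leaves r)"
proof -
  have "distinct (leaves l)" "distinct (leaves r)"
    using assms by (auto simp: sorted_wrt_append strict_sorted_iff)
  then show ?thesis
    using leaf_pairs_Node[OF assms]
    by (simp add: card_Un_disjoint card_cartesian_product distinct_card)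
qed

text \<open>Pairs are sorted by where they meet. A pair inside a child acts on the list of that
  child alone, under the same condition, since only leaves below the lowest common ancestor block a
  move. For a pair meeting at the root every element blocks, so the pair has to be adjacent.\<close>

lemma tree_op_Node:
  assumes sorted: "sorted_wrt (<) (leaves (Node q l r))"
    and w: "w \<in> words (length (leaves l)) (length (leaves r))"
    and s: "s \<in> tree_perms l" and t: "t \<in> tree_perms r"
  shows "tree_op (Node q l r) f (shuffle_by w s t)
    = tree_op l (\<lambda>s'. f (shuffle_by w s' t)) s + tree_op r (\<lambda>t'. f (shuffle_by w s t')) t
      + word_op q (length (leaves l)) (length (leaves r)) (\<lambda>w'. f (shuffle_by w' s t)) w"
proof -
  let ?T = "Node q l r" and ?A = "set (leaves l)" and ?B = "set (leaves r)"
  define \<sigma> where "\<sigma> = shuffle_by w s t"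
  have dis: "distinct (leaves ?T)" using sorted strict_sorted_iff by blast
  note sh = tree_perms_shuffle[OF dis w s t, folded \<sigma>_def]
  have \<sigma>: "distinct \<sigma>" "set \<sigma> = ?A \<union> ?B" using sh(1) by (auto simp: permutations_of_set_def)
  have AB: "?A \<inter> ?B = {}" "distinct (leaves l)" "distinct (leaves r)" using dis by auto
  have left: "pair_update ?T f \<sigma> a b = pair_update l (\<lambda>s'. f (shuffle_by w s' t)) s a b"
    if ab: "(a, b) \<in> leaf_pairs l" for a b
  proof -
    have ab': "a \<in> ?A" "b \<in> ?A" "a \<noteq> b" using ab by (auto simp: leaf_pairs_def)
    have pl: "place \<sigma> x y = shuffle_by w (place s x y) t" if "x \<in> ?A" "y \<in> ?A" "x \<noteq> y" for x y
      using shuffle_by_filter[of "\<lambda>x. x \<in> ?A" "place \<sigma> x y"] that \<sigma> sh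
        place_filter[of \<sigma> x y "\<lambda>x. x \<in> ?A"] place_map[of \<sigma> x y "\<lambda>x. x \<in> ?A"] by auto
    have "between s a b = between \<sigma> a b \<inter> ?A"
      using place_filter(3)[of \<sigma> a b "\<lambda>x. x \<in> ?A"] ab' \<sigma> sh by auto
    then have "between \<sigma> a b \<inter> set (leaves (lca l a b)) = between s a b \<inter> set (leaves (lca l a b))"
      using lca_mem(2)[OF ab AB(2)] by auto
    then show ?thesis
      using ab' pl[of a b] pl[of b a] by (simp add: pair_update_def \<sigma>_def[symmetric])
  qed
  have right: "pair_update ?T f \<sigma> a b = pair_update r (\<lambda>t'. f (shuffle_by w s t')) t a b"
    if ab: "(a, b) \<in> leaf_pairs r" for a b
  proof -
    have ab': "a \<in> ?B" "b \<in> ?B" "a \<noteq> b" using ab by (auto simp: leaf_pairs_def)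
    have nA: "a \<notin> ?A" "b \<notin> ?A" using ab' AB by auto
    have pl: "place \<sigma> x y = shuffle_by w s (place t x y)" if "x \<in> ?B" "y \<in> ?B" "x \<noteq> y" for x y
    proof -
      have "x \<notin> ?A" "y \<notin> ?A" using that AB by auto
      then show ?thesis
        using shuffle_by_filter[of "\<lambda>x. x \<in> ?A" "place \<sigma> x y"] that \<sigma> sh
          place_filter[of \<sigma> x y "\<lambda>x. x \<notin> ?A"] place_map[of \<sigma> x y "\<lambda>x. x \<in> ?A"] by auto
    qed
    have "between t a b = between \<sigma> a b \<inter> - ?A"
      using place_filter(3)[of \<sigma> a b "\<lambda>x. x \<notin> ?A"] ab' nA \<sigma> sh by auto
    then have "between \<sigma> a b \<inter> set (leaves (lca r a b)) = between t a b \<inter> set (leaves (lca r a b))"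
      using lca_mem(2)[OF ab AB(3)] AB(1) by auto
    then show ?thesis
      using ab' nA pl[of a b] pl[of b a] by (simp add: pair_update_def \<sigma>_def[symmetric])
  qed
  have cross: "pair_update ?T f \<sigma> a b = (if between \<sigma> a b = {}
            then q * f (place \<sigma> a b) + (1 - q) * f (place \<sigma> b a) else f \<sigma>)"
    if ab: "a \<in> ?A" "b \<in> ?B" for a b
  proof -
    have nA: "b \<notin> ?A" "a \<notin> ?B" "a \<noteq> b" using ab AB by auto
    have "between \<sigma> a b \<subseteq> set \<sigma>"
    proof -
      have "a \<in> set \<sigma>" "b \<in> set \<sigma>" using ab \<sigma> by auto
      from split_list_two[OF this nA(3)] obtain xs c ys d zs where dec: "\<sigma> = xs @ c # ys @ d # zs"
        and cd: "(c = a \<and> d = b) \<or> (c = b \<and> d = a)"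
        by metis
      show ?thesis using cd between_append[of xs c ys d zs] \<sigma>(1) by (auto simp: dec)
    qed
    then have "between \<sigma> a b \<inter> (?A \<union> ?B) = between \<sigma> a b" using \<sigma> by auto
    then show ?thesis using nA ab by (simp add: pair_update_def)
  qed
  have "tree_op ?T f \<sigma> = (\<Sum>(a, b)\<in>leaf_pairs l. pair_update ?T f \<sigma> a b)
      + ((\<Sum>(a, b)\<in>leaf_pairs r. pair_update ?T f \<sigma> a b)
        + (\<Sum>(a, b)\<in>?A \<times> ?B. pair_update ?T f \<sigma> a b))"
    unfolding tree_op_def leaf_pairs_Node(1)[OF sorted] using leaf_pairs_Node(2,3)[OF sorted]
    by (subst sum.union_disjoint, simp, simp, simp, subst sum.union_disjoint) auto
  also have "(\<Sum>(a, b)\<in>leaf_pairs l. pair_update ?T f \<sigma> a b) = tree_op l (\<lambda>s'. f (shuffle_by w s' t)) s"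
    unfolding tree_op_def using left by (intro sum.cong) auto
  also have "(\<Sum>(a, b)\<in>leaf_pairs r. pair_update ?T f \<sigma> a b) = tree_op r (\<lambda>t'. f (shuffle_by w s t')) t"
    unfolding tree_op_def using right by (intro sum.cong) auto
  also have "(\<Sum>(a, b)\<in>?A \<times> ?B. pair_update ?T f \<sigma> a b) = (\<Sum>(a, b)\<in>?A \<times> ?B. if between \<sigma> a b = {}
            then q * f (place \<sigma> a b) + (1 - q) * f (place \<sigma> b a) else f \<sigma>)"
    using cross by (intro sum.cong) auto
  also have "\<dots> = word_op q (card ?A) (card ?B) (\<lambda>w'. f (shuffle_by w' s t)) w"
    using sum_cross_pairs[OF \<sigma> AB(1)] sh by metis
  finally show ?thesis using AB(2,3) by (simp add: \<sigma>_def distinct_card)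
qed

section \<open>Contraction and diameter\<close>

text \<open>The weight of an exchange is computed from the word of its node alone and handed
  unchanged to all ancestors, so changing another coordinate carries an edge to an edge of equal
  weight. One orientation suffices, as only absolute differences are compared.\<close>

inductive edge :: "ltree \<Rightarrow> nat list \<Rightarrow> nat list \<Rightarrow> real \<Rightarrow> bool" where
  node: "us @ True # False # vs \<in> words (length (leaves l)) (length (leaves r)) \<Longrightarrow>
     s \<in> tree_perms l \<Longrightarrow> t \<in> tree_perms r \<Longrightarrow>
     edge (Node q l r) (shuffle_by (us @ True # False # vs) s t)
       (shuffle_by (us @ False # True # vs) s t)
       (tile_weight q (length (leaves l) + length (leaves r)) (length us) (count_list us True))"
| left: "edge l s s' x \<Longrightarrow> w \<in> words (length (leaves l)) (length (leaves r)) \<Longrightarrow>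
     t \<in> tree_perms r \<Longrightarrow> edge (Node q l r) (shuffle_by w s t) (shuffle_by w s' t) x"
| right: "edge r t t' x \<Longrightarrow> w \<in> words (length (leaves l)) (length (leaves r)) \<Longrightarrow>
     s \<in> tree_perms l \<Longrightarrow> edge (Node q l r) (shuffle_by w s t) (shuffle_by w s t') x"

definition lipschitz_tree :: "ltree \<Rightarrow> real \<Rightarrow> (nat list \<Rightarrow> real) \<Rightarrow> bool" where
  "lipschitz_tree T A f \<longleftrightarrow> (\<forall>\<sigma> \<sigma>' x. edge T \<sigma> \<sigma>' x \<longrightarrow> \<bar>f \<sigma> - f \<sigma>'\<bar> \<le> A * x)"

lemma contraction_rate_range:
  assumes "contraction_rate n \<gamma> q"
  shows "q \<in> {0..1}"
  using assms by (auto simp: contraction_rate_def)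

lemma words_swap:
  "us @ True # False # vs \<in> words a b \<longleftrightarrow> us @ False # True # vs \<in> words a b"
  by (auto simp: words_def)

lemma edge_in_tree_perms:
  assumes "edge T \<sigma> \<sigma>' x" "distinct (leaves T)"
  shows "\<sigma> \<in> tree_perms T \<and> \<sigma>' \<in> tree_perms T"
  using assms
proof (induction rule: edge.induct)
  case node
  then show ?case using tree_perms_shuffle(1) words_swap by blast
next
  case (left l s s' x w r t q)
  then have "distinct (leaves l)" by simp
  then show ?case using left tree_perms_shuffle(1) by blast
next
  case (right r t t' x w l s q)
  then have "distinct (leaves r)" by simp
  then show ?case using right tree_perms_shuffle(1) by blast
qed

text \<open>Up to the factor \<open>card (leaf_pairs T)\<close> the operator averages values, so it
  cannot enlarge a uniform difference. This serves the coordinates not touched by an edge, with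
  \<open>f\<close> and \<open>g\<close> obtained by fixing the touched coordinate at either
  end.\<close>

lemma tree_op_diff_le:
  assumes "distinct (leaves T)" "node_labels T \<subseteq> {0..1}" "\<sigma> \<in> tree_perms T"
    and "\<And>\<tau>. \<tau> \<in> tree_perms T \<Longrightarrow> \<bar>f \<tau> - g \<tau>\<bar> \<le> c"
  shows "\<bar>tree_op T f \<sigma> - tree_op T g \<sigma>\<bar> \<le> real (card (leaf_pairs T)) * c"
proof -
  have "\<bar>pair_update T f \<sigma> a b - pair_update T g \<sigma> a b\<bar> \<le> c" if ab: "(a, b) \<in> leaf_pairs T" for a b
  proof -
    have q: "0 \<le> root_label (lca T a b)" "root_label (lca T a b) \<le> 1"
      using lca_mem(1)[OF ab assms(1)] assms(2) by auto
    have "place \<sigma> a b \<in> tree_perms T" "place \<sigma> b a \<in> tree_perms T"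
      using ab assms(3) by (auto simp: leaf_pairs_def intro!: place_in_permutations)
    then show ?thesis
      using convex_bound_le_abs[OF assms(4) assms(4) q] assms(3,4) by (auto simp: pair_update_def)
  qed
  then have "\<bar>\<Sum>x\<in>leaf_pairs T. pair_update T f \<sigma> (fst x) (snd x) - pair_update T g \<sigma> (fst x) (snd x)\<bar>
      \<le> (\<Sum>x\<in>leaf_pairs T. c)"
    by (intro order_trans[OF sum_abs] sum_mono) auto
  then show ?thesis by (simp add: tree_op_def sum_subtractf split_def)
qed

text \<open>This is \<open>(a - 1) * (b - 1) \<ge> 0\<close>; it makes the idle coefficient in
  \<open>word_op\<close> nonnegative.\<close>

lemma pred_sum_le_mult:
  fixes a b :: nat
  assumes "1 \<le> a" "1 \<le> b"
  shows "a + b - 1 \<le> a * b"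
proof -
  obtain a' b' where "a = Suc a'" "b = Suc b'" using assms by (metis Suc_le_D One_nat_def)
  then show ?thesis by simp
qed

lemma length_leaves_pos: "1 \<le> length (leaves T)"
  by (induction T) auto

lemma words_update:
  assumes "w \<in> words a b" "Suc k < length w" "w ! k \<noteq> w ! Suc k"
  shows "w[k := True, Suc k := False] \<in> words a b" "w[k := False, Suc k := True] \<in> words a b"
proof -
  obtain us x y vs where w: "w = us @ x # y # vs" "length us = k"
    using split_at_two[OF assms(2)] by metis
  then have "x \<noteq> y" using assms(3) by (auto simp: nth_append)
  then show "w[k := True, Suc k := False] \<in> words a b" "w[k := False, Suc k := True] \<in> words a b"
    using assms(1) w by (auto simp: words_def list_update_append split: if_splits)
qed

lemma word_op_diff_le:
  assumes q: "0 \<le> q" "q \<le> 1" and ab: "1 \<le> a" "1 \<le> b" and w: "w \<in> words a b"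
    and fg: "\<And>w. w \<in> words a b \<Longrightarrow> \<bar>f w - g w\<bar> \<le> c"
  shows "\<bar>word_op q a b f w - word_op q a b g w\<bar> \<le> real (a * b) * c"
proof -
  have le: "real (a + b - 1) \<le> real (a * b)" using pred_sum_le_mult[OF ab] by (simp only: of_nat_le_iff)
  have "\<bar>flip q k f w - flip q k g w\<bar> \<le> c" if "k < a + b - 1" for k
    using convex_bound_le_abs[OF fg fg q, OF words_update[OF w]] fg[OF w] length_words[OF w] that
    by (auto simp: flip_def)
  then have "\<bar>\<Sum>k<a + b - 1. flip q k f w - flip q k g w\<bar> \<le> (\<Sum>k<a + b - 1. c)"
    by (intro order_trans[OF sum_abs] sum_mono) auto
  then have "\<bar>\<Sum>k<a + b - 1. flip q k f w - flip q k g w\<bar> \<le> real (a + b - 1) * c"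
    by simp
  moreover have "\<bar>(real (a * b) - real (a + b - 1)) * (f w - g w)\<bar> \<le> (real (a * b) - real (a + b - 1)) * c"
    unfolding abs_mult using fg[OF w] le by (intro mult_mono) auto
  moreover have "word_op q a b f w - word_op q a b g w =
     (real (a * b) - real (a + b - 1)) * (f w - g w) + (\<Sum>k<a + b - 1. flip q k f w - flip q k g w)"
    by (simp add: word_op_def sum_subtractf algebra_simps)
  ultimately have "\<bar>word_op q a b f w - word_op q a b g w\<bar>
    \<le> (real (a * b) - real (a + b - 1)) * c + real (a + b - 1) * c"
    by linarith
  then show ?thesis by (simp add: algebra_simps)
qed

text \<open>The idle part keeps the Lipschitz bound with its coefficient; the gain
  \<open>\<gamma>\<close> comes from \<open>sum_flip_contract\<close>.\<close>

lemma word_op_contract: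
  assumes c: "contraction_rate n \<gamma> q" and A: "0 \<le> A" and n: "a + b \<le> n" and ab: "1 \<le> a" "1 \<le> b"
    and lip: "\<And>us vs. us @ True # False # vs \<in> words a b \<Longrightarrow>
      \<bar>g (us @ True # False # vs) - g (us @ False # True # vs)\<bar>
        \<le> A * tile_weight q (a + b) (length us) (count_list us True)"
    and w: "us @ True # False # vs \<in> words a b"
  shows "\<bar>word_op q a b g (us @ True # False # vs) - word_op q a b g (us @ False # True # vs)\<bar>
    \<le> (real (a * b) - \<gamma>) * (A * tile_weight q (a + b) (length us) (count_list us True))"
proof -
  let ?x = "A * tile_weight q (a + b) (length us) (count_list us True)"
  let ?w = "us @ True # False # vs" and ?w' = "us @ False # True # vs"
  have le: "real (a + b - 1) \<le> real (a * b)" using pred_sum_le_mult[OF ab] by (simp only: of_nat_le_iff)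
  \<comment> \<open>The surroundings of the exchanged pair contain one \<open>True\<close> less than
    the word.\<close>
  have len: "length us + length vs + 2 = a + b" "count_list (us @ vs) True = a - 1"
    using length_words[OF w] w ab by (auto simp: words_def)
  have words: "xs @ True # False # ys \<in> words a b"
    if "length xs + length ys + 2 = a + b" "count_list (xs @ ys) True = a - 1" for xs ys
  proof -
    have "length (xs @ ys) = count_list (xs @ ys) True + count_list (xs @ ys) False" 
      using length_words[of "xs @ ys"] unfolding words_def by blast
    then show ?thesis using that ab by (simp add: words_def)
  qed
  have 1: "\<bar>(\<Sum>k<a + b - 1. flip q k g ?w) - (\<Sum>k<a + b - 1. flip q k g ?w')\<bar>
      \<le> (real (a + b - 1) - \<gamma>) * ?x"
    using sum_flip_contract[OF c A n lip[OF words] len] by simp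
  have 2: "\<bar>(real (a * b) - real (a + b - 1)) * (g ?w - g ?w')\<bar> \<le> (real (a * b) - real (a + b - 1)) * ?x"
    unfolding abs_mult using lip[OF w] le by (intro mult_mono) auto
  have "word_op q a b g ?w - word_op q a b g ?w' = (real (a * b) - real (a + b - 1)) * (g ?w - g ?w')
      + ((\<Sum>k<a + b - 1. flip q k g ?w) - (\<Sum>k<a + b - 1. flip q k g ?w'))"
    by (simp add: word_op_def algebra_simps)
  then have "\<bar>word_op q a b g ?w - word_op q a b g ?w'\<bar>
     \<le> (real (a * b) - real (a + b - 1)) * ?x + (real (a + b - 1) - \<gamma>) * ?x"
    using 1 2 by linarith
  then show ?thesis by (simp add: algebra_simps)
qed

text \<open>Of the three summands in \<open>tree_op_Node\<close>, the two without the exchange are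
  nonexpansive. The one containing it gains \<open>\<gamma>\<close>, by
  \<open>word_op_contract\<close> at the node itself and by the induction hypothesis inside a child.
  The factors add up to \<open>card (leaf_pairs T) - \<gamma>\<close>.\<close>

lemma tree_op_contract_edge:
  assumes "edge T \<sigma> \<sigma>' x" "sorted_wrt (<) (leaves T)" "length (leaves T) \<le> n"
    "\<forall>q\<in>node_labels T. contraction_rate n \<gamma> q" "0 \<le> A" "lipschitz_tree T A f"
  shows "\<bar>tree_op T f \<sigma> - tree_op T f \<sigma>'\<bar> \<le> (real (card (leaf_pairs T)) - \<gamma>) * (A * x)"
  using assms
proof (induction arbitrary: f rule: edge.induct)
  case (node us vs l r s t q)
  let ?w = "us @ True # False # vs" and ?w' = "us @ False # True # vs"
  let ?x = "tile_weight q (length (leaves l) + length (leaves r)) (length us) (count_list us True)"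
  have w': "?w' \<in> words (length (leaves l)) (length (leaves r))" using node words_swap by blast
  have lr: "sorted_wrt (<) (leaves l)" "sorted_wrt (<) (leaves r)"
    using node.prems by (auto simp: sorted_wrt_append)
  then have dis: "distinct (leaves l)" "distinct (leaves r)" by (simp_all add: strict_sorted_iff)
  have lab0: "node_labels (Node q l r) \<subseteq> {0..1}"
    using node.prems(3) contraction_rate_range by blast
  have lab: "node_labels l \<subseteq> {0..1}" "node_labels r \<subseteq> {0..1}"
    using lab0 by auto
  have lip: "\<bar>f (shuffle_by (us' @ True # False # vs') s' t') - f (shuffle_by (us' @ False # True # vs') s' t')\<bar>
      \<le> A * tile_weight q (length (leaves l) + length (leaves r)) (length us') (count_list us' True)"
    if "us' @ True # False # vs' \<in> words (length (leaves l)) (length (leaves r))"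
      "s' \<in> tree_perms l" "t' \<in> tree_perms r" for us' vs' s' t'
    using node.prems(5) edge.node[OF that] unfolding lipschitz_tree_def by blast
  note op = tree_op_Node[OF node.prems(1) node.hyps(1,2,3), of f]
    tree_op_Node[OF node.prems(1) w' node.hyps(2,3), of f]
  \<comment> \<open>For every order of the left leaves the two words still span an edge of the same
    weight, which is the uniform bound required.\<close>
  have "\<bar>tree_op l (\<lambda>s'. f (shuffle_by ?w s' t)) s - tree_op l (\<lambda>s'. f (shuffle_by ?w' s' t)) s\<bar>
      \<le> real (card (leaf_pairs l)) * (A * ?x)"
    using lip node.hyps by (intro tree_op_diff_le dis lab) auto
  moreover have "\<bar>tree_op r (\<lambda>t'. f (shuffle_by ?w s t')) t - tree_op r (\<lambda>t'. f (shuffle_by ?w' s t')) t\<bar>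
      \<le> real (card (leaf_pairs r)) * (A * ?x)"
    using lip node.hyps by (intro tree_op_diff_le dis lab) auto
  moreover have "\<bar>word_op q (length (leaves l)) (length (leaves r)) (\<lambda>w'. f (shuffle_by w' s t)) ?w
      - word_op q (length (leaves l)) (length (leaves r)) (\<lambda>w'. f (shuffle_by w' s t)) ?w'\<bar>
      \<le> (real (length (leaves l) * length (leaves r)) - \<gamma>) * (A * ?x)"
    using node.prems lip node.hyps by (intro word_op_contract[where n = n] length_leaves_pos) auto
  ultimately show ?case
    unfolding op card_leaf_pairs_Node[OF node.prems(1)] by (simp add: algebra_simps)
next
  case (left l s s' x w r t q)
  have lr: "sorted_wrt (<) (leaves l)" "sorted_wrt (<) (leaves r)"
    using left.prems by (auto simp: sorted_wrt_append)
  then have dis: "distinct (leaves l)" "distinct (leaves r)" by (simp_all add: strict_sorted_iff)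
  have s: "s \<in> tree_perms l" "s' \<in> tree_perms l"
    using edge_in_tree_perms[OF left.hyps(1) dis(1)] by auto
  have lab0: "node_labels (Node q l r) \<subseteq> {0..1}"
    using left.prems(3) contraction_rate_range by blast
  have lab: "node_labels r \<subseteq> {0..1}" and q: "0 \<le> q" "q \<le> 1"
    using lab0 by auto
  have lip: "\<bar>f (shuffle_by w' s1 t') - f (shuffle_by w' s2 t')\<bar> \<le> A * y"
    if "edge l s1 s2 y" "w' \<in> words (length (leaves l)) (length (leaves r))" "t' \<in> tree_perms r"
    for w' t' s1 s2 y
    using left.prems(5) edge.left[OF that] unfolding lipschitz_tree_def by blast
  note op = tree_op_Node[OF left.prems(1) left.hyps(2) s(1) left.hyps(3), of f]
    tree_op_Node[OF left.prems(1) left.hyps(2) s(2) left.hyps(3), of f]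
  have "\<bar>tree_op l (\<lambda>s'. f (shuffle_by w s' t)) s - tree_op l (\<lambda>s'. f (shuffle_by w s' t)) s'\<bar>
      \<le> (real (card (leaf_pairs l)) - \<gamma>) * (A * x)"
    using lip left.hyps left.prems by (intro left.IH lr) (auto simp: lipschitz_tree_def)
  moreover have "\<bar>tree_op r (\<lambda>t'. f (shuffle_by w s t')) t - tree_op r (\<lambda>t'. f (shuffle_by w s' t')) t\<bar>
      \<le> real (card (leaf_pairs r)) * (A * x)"
    using lip left.hyps by (intro tree_op_diff_le dis lab) auto
  moreover have "\<bar>word_op q (length (leaves l)) (length (leaves r)) (\<lambda>w'. f (shuffle_by w' s t)) w
      - word_op q (length (leaves l)) (length (leaves r)) (\<lambda>w'. f (shuffle_by w' s' t)) w\<bar>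
      \<le> real (length (leaves l) * length (leaves r)) * (A * x)"
    using lip left.hyps q by (intro word_op_diff_le length_leaves_pos) auto
  ultimately show ?case
    unfolding op card_leaf_pairs_Node[OF left.prems(1)] by (simp add: algebra_simps)
next
  case (right r t t' x w l s q)
  have lr: "sorted_wrt (<) (leaves l)" "sorted_wrt (<) (leaves r)"
    using right.prems by (auto simp: sorted_wrt_append)
  then have dis: "distinct (leaves l)" "distinct (leaves r)" by (simp_all add: strict_sorted_iff)
  have t: "t \<in> tree_perms r" "t' \<in> tree_perms r"
    using edge_in_tree_perms[OF right.hyps(1) dis(2)] by auto
  have lab0: "node_labels (Node q l r) \<subseteq> {0..1}"
    using right.prems(3) contraction_rate_range by blast
  have lab: "node_labels l \<subseteq> {0..1}" and q: "0 \<le> q" "q \<le> 1"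
    using lab0 by auto
  have lip: "\<bar>f (shuffle_by w' s' t1) - f (shuffle_by w' s' t2)\<bar> \<le> A * y"
    if "edge r t1 t2 y" "w' \<in> words (length (leaves l)) (length (leaves r))" "s' \<in> tree_perms l"
    for w' s' t1 t2 y
    using right.prems(5) edge.right[OF that] unfolding lipschitz_tree_def by blast
  note op = tree_op_Node[OF right.prems(1) right.hyps(2,3) t(1), of f]
    tree_op_Node[OF right.prems(1) right.hyps(2,3) t(2), of f]
  have "\<bar>tree_op r (\<lambda>t'. f (shuffle_by w s t')) t - tree_op r (\<lambda>t'. f (shuffle_by w s t')) t'\<bar>
      \<le> (real (card (leaf_pairs r)) - \<gamma>) * (A * x)"
    using lip right.hyps right.prems by (intro right.IH lr) (auto simp: lipschitz_tree_def)
  moreover have "\<bar>tree_op l (\<lambda>s'. f (shuffle_by w s' t)) s - tree_op l (\<lambda>s'. f (shuffle_by w s' t')) s\<bar>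
      \<le> real (card (leaf_pairs l)) * (A * x)"
    using lip right.hyps by (intro tree_op_diff_le dis lab) auto
  moreover have "\<bar>word_op q (length (leaves l)) (length (leaves r)) (\<lambda>w'. f (shuffle_by w' s t)) w
      - word_op q (length (leaves l)) (length (leaves r)) (\<lambda>w'. f (shuffle_by w' s t')) w\<bar>
      \<le> real (length (leaves l) * length (leaves r)) * (A * x)"
    using lip right.hyps q by (intro word_op_diff_le length_leaves_pos) auto
  ultimately show ?case
    unfolding op card_leaf_pairs_Node[OF right.prems(1)] by (simp add: algebra_simps)
qed

lemma tree_op_contract:
  assumes "sorted_wrt (<) (leaves T)" "length (leaves T) \<le> n"
    "\<forall>q\<in>node_labels T. contraction_rate n \<gamma> q" "0 \<le> A" "lipschitz_tree T A f"
  shows "lipschitz_tree T ((real (card (leaf_pairs T)) - \<gamma>) * A) (tree_op T f)"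
  using tree_op_contract_edge[OF _ assms] by (simp add: lipschitz_tree_def mult.assoc)

section \<open>Sizes of weights and lengths of paths\<close>

lemma edge_weight_bounds:
  assumes "edge T \<sigma> \<sigma>' x" "length (leaves T) \<le> n" "\<forall>q\<in>node_labels T. 1/2 \<le> q"
  shows "1 / 3 ^ n \<le> x \<and> x \<le> 3 ^ n * real n ^ 2"
  using assms
proof (induction rule: edge.induct)
  case (node us vs l r s t q)
  have "Suc (length us) < length (leaves l) + length (leaves r)"
    using length_words[OF node.hyps(1)] by simp
  moreover have "count_list us True \<le> length us" by (rule count_le_length)
  ultimately show ?case
    using tile_weight_bounds[of q "count_list us True" "length us"
        "length (leaves l) + length (leaves r)" n] node.prems by simp
qed auto

text \<open>Words with different first letters are joined by one exchange at the front between two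
  recursive paths on the tails, so lengths obey
  \<open>2 * (2 ^ m - 1) + 1 = 2 ^ (m + 1) - 1\<close>. An exponential length is affordable: the
  weights are exponential anyway, and only the logarithm enters.\<close>

lemma word_path_bound:
  fixes g :: "bool list \<Rightarrow> real"
  assumes "\<And>us vs. length us + length vs + 2 = m \<Longrightarrow> count_list (us @ vs) True + 1 = a \<Longrightarrow>
      \<bar>g (us @ True # False # vs) - g (us @ False # True # vs)\<bar> \<le> W"
    and "0 \<le> W" "length w = m" "length w' = m" "count_list w True = a" "count_list w' True = a"
  shows "\<bar>g w - g w'\<bar> \<le> (2 ^ m - 1) * W"
  using assms
proof (induction m arbitrary: g a w w')
  case (Suc m)
  have IH: "\<bar>g (x # v) - g (x # v')\<bar> \<le> (2 ^ m - 1) * W"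
    if "length v = m" "length v' = m" "count_list v True = count_list v' True"
      "count_list (x # v) True = a" for x v v'
  proof (rule Suc.IH[of "count_list v True" "\<lambda>u. g (x # u)"])
    fix us vs :: "bool list"
    assume "length us + length vs + 2 = m" "count_list (us @ vs) True + 1 = count_list v True"
    then show "\<bar>g (x # us @ True # False # vs) - g (x # us @ False # True # vs)\<bar> \<le> W"
      using Suc.prems(1)[of "x # us" vs] that(4) by (auto split: if_splits)
  qed (use that Suc.prems in auto)
  have mixed: "\<bar>g (True # v) - g (False # v')\<bar> \<le> (2 ^ Suc m - 1) * W"
    if v: "length v = m" "length v' = m" "Suc (count_list v True) = a" "count_list v' True = a" for v v'
  proof -
    \<comment> \<open>Otherwise \<open>v'\<close>, which also has length \<open>m\<close>, would
      contain \<open>m + 1\<close> times \<open>True\<close>.\<close>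
    have "False \<in> set v"
    proof (rule ccontr)
      assume "False \<notin> set v"
      then have "count_list v True = length v" by (induction v) auto
      then show False using v count_le_length[of v' True] by simp
    qed
    then obtain v1 v2 where vv: "v = v1 @ False # v2" by (meson split_list)
    let ?u = "v1 @ v2"
    have u: "length (False # ?u) = m" "Suc (count_list ?u True) = a" "length ?u + 2 = Suc m"
      using v vv by auto
    have "\<bar>g (True # v) - g (True # False # ?u)\<bar> \<le> (2 ^ m - 1) * W"
      using IH[of v "False # ?u" True] v u vv by auto
    moreover have "\<bar>g (True # False # ?u) - g (False # True # ?u)\<bar> \<le> W"
      using Suc.prems(1)[of "[]" ?u] u by simp
    moreover have "\<bar>g (False # True # ?u) - g (False # v')\<bar> \<le> (2 ^ m - 1) * W"
      using IH[of "True # ?u" v' False] v u by auto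
    ultimately show ?thesis by (simp add: algebra_simps)
  qed
  obtain x v where w: "w = x # v" "length v = m" using Suc.prems(3) by (cases w) auto
  obtain x' v' where w': "w' = x' # v'" "length v' = m" using Suc.prems(4) by (cases w') auto
  consider "x = x'" | "x" "\<not> x'" | "\<not> x" "x'" by blast
  then show ?case
  proof cases
    case 1
    have "\<bar>g w - g w'\<bar> \<le> (2 ^ m - 1) * W"
      using IH[of v v' x] w w' 1 Suc.prems(5,6) by (auto split: if_splits)
    also have "\<dots> \<le> (2 ^ Suc m - 1) * W" using Suc.prems(2) by (intro mult_right_mono) auto
    finally show ?thesis .
  next
    case 2
    then show ?thesis using mixed[of v v'] w w' Suc.prems(5,6) by auto
  next
    case 3
    then show ?thesis using mixed[of v' v] w w' Suc.prems(5,6) by (auto simp: abs_minus_commute)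
  qed
qed simp

text \<open>The words are changed one node at a time, and there is one internal node less than there
  are leaves.\<close>

lemma tree_path_bound:
  assumes "distinct (leaves T)" "length (leaves T) \<le> n" "0 \<le> W"
    and "\<And>\<sigma> \<sigma>' x. edge T \<sigma> \<sigma>' x \<Longrightarrow> \<bar>f \<sigma> - f \<sigma>'\<bar> \<le> W"
    and "\<sigma> \<in> tree_perms T" "\<sigma>' \<in> tree_perms T"
  shows "\<bar>f \<sigma> - f \<sigma>'\<bar> \<le> (real (length (leaves T)) - 1) * (2 ^ n * W)"
  using assms
proof (induction T arbitrary: f \<sigma> \<sigma>')
  case (Leaf k)
  then show ?case by (simp add: permutations_of_set_singleton)
next
  case (Node q l r)
  have dis: "distinct (leaves l)" "distinct (leaves r)" using Node.prems by auto
  obtain w s t where 1: "w \<in> words (length (leaves l)) (length (leaves r))"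
    "s \<in> tree_perms l" "t \<in> tree_perms r" "\<sigma> = shuffle_by w s t"
    using tree_perms_obtain_shuffle[OF Node.prems(1,5)] by blast
  obtain w' s' t' where 2: "w' \<in> words (length (leaves l)) (length (leaves r))"
    "s' \<in> tree_perms l" "t' \<in> tree_perms r" "\<sigma>' = shuffle_by w' s' t'"
    using tree_perms_obtain_shuffle[OF Node.prems(1,6)] by blast
  let ?m = "length (leaves l) + length (leaves r)"
  have "\<bar>f (shuffle_by w s t) - f (shuffle_by w' s t)\<bar> \<le> (2 ^ ?m - 1) * W"
  proof (rule word_path_bound[where a = "length (leaves l)" and g = "\<lambda>w. f (shuffle_by w s t)"])
    fix us vs :: "bool list"
    assume a: "length us + length vs + 2 = ?m" "count_list (us @ vs) True + 1 = length (leaves l)"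
    have "length (us @ vs) = count_list (us @ vs) True + count_list (us @ vs) False"
      using length_words[of "us @ vs"] unfolding words_def by blast
    then have "us @ True # False # vs \<in> words (length (leaves l)) (length (leaves r))"
      using a by (simp add: words_def)
    then show "\<bar>f (shuffle_by (us @ True # False # vs) s t) - f (shuffle_by (us @ False # True # vs) s t)\<bar> \<le> W"
      using Node.prems(4) edge.node 1 by blast
  qed (use 1 2 Node.prems length_words in \<open>auto simp: words_def\<close>)
  also have "\<dots> \<le> 2 ^ n * W"
  proof -
    have "(2::real) ^ ?m - 1 \<le> 2 ^ ?m" by simp
    also have "\<dots> \<le> 2 ^ n" using Node.prems by (intro power_increasing) auto
    finally show ?thesis using Node.prems by (intro mult_right_mono) auto
  qed
  finally have a: "\<bar>f (shuffle_by w s t) - f (shuffle_by w' s t)\<bar> \<le> 2 ^ n * W" .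
  have b: "\<bar>f (shuffle_by w' s t) - f (shuffle_by w' s' t)\<bar> \<le> (real (length (leaves l)) - 1) * (2 ^ n * W)"
  proof (rule Node.IH(1)[OF dis(1), where f = "\<lambda>s. f (shuffle_by w' s t)"])
    fix u u' x assume "edge l u u' x"
    then show "\<bar>f (shuffle_by w' u t) - f (shuffle_by w' u' t)\<bar> \<le> W"
      using Node.prems(4) edge.left[OF _ 2(1) 1(3)] by blast
  qed (use Node.prems 1 2 in auto)
  have c: "\<bar>f (shuffle_by w' s' t) - f (shuffle_by w' s' t')\<bar> \<le> (real (length (leaves r)) - 1) * (2 ^ n * W)"
  proof (rule Node.IH(2)[OF dis(2), where f = "\<lambda>t. f (shuffle_by w' s' t)"])
    fix u u' x assume "edge r u u' x"
    then show "\<bar>f (shuffle_by w' s' u) - f (shuffle_by w' s' u')\<bar> \<le> W"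
      using Node.prems(4) edge.right[OF _ 2(1,2)] by blast
  qed (use Node.prems 1 2 in auto)
  show ?case using a b c unfolding 1(4) 2(4) by (simp add: algebra_simps)
qed

section \<open>Stationarity of the target distribution\<close>

text \<open>The leaves below a node form an interval of the leaf order, and a path from an outside
  leaf enters the subtree at its root. Hence the elements that may stand between \<open>a\<close>
  and \<open>b\<close> in a move cannot tell them apart through \<open>p\<close>.\<close>

lemma lca_outside:
  assumes "sorted_wrt (<) (leaves T)" "a \<in> set (leaves T)" "b \<in> set (leaves T)" "y \<in> set (leaves T)"
    "y \<notin> set (leaves (lca T a b))"
  shows "lca T a y = lca T b y \<and> lca T y a = lca T y b \<and> (a < y \<longleftrightarrow> b < y)"
  using assms
proof (induction T)
  case (Node q l r)
  have lr: "sorted_wrt (<) (leaves l)" "sorted_wrt (<) (leaves r)"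
    and less: "\<And>x z. x \<in> set (leaves l) \<Longrightarrow> z \<in> set (leaves r) \<Longrightarrow> x < z"
    using Node.prems(1) by (auto simp: sorted_wrt_append)
  have notin: "x \<notin> set (leaves r)" if "x \<in> set (leaves l)" for x
    using less[OF that] by blast
  consider "a \<in> set (leaves l)" "b \<in> set (leaves l)" | "a \<in> set (leaves r)" "b \<in> set (leaves r)"
    | "a \<in> set (leaves l)" "b \<in> set (leaves r)" | "a \<in> set (leaves r)" "b \<in> set (leaves l)"
    using Node.prems by auto
  then show ?case
  proof cases
    case 1
    then show ?thesis
      using Node.IH(1)[OF lr(1)] Node.prems notin less by (cases "y \<in> set (leaves l)") auto
  next
    case 2
    then have na: "a \<notin> set (leaves l)" "b \<notin> set (leaves l)" using notin by auto
    show ?thesis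
    proof (cases "y \<in> set (leaves l)")
      case True
      then have "\<not> a < y" "\<not> b < y" using less 2 by (meson less_asym)+
      then show ?thesis using 2 na notin[OF True] True by simp
    next
      case False
      then show ?thesis using Node.IH(2)[OF lr(2)] Node.prems 2 na by auto
    qed
  next
    case 3
    then have "b \<notin> set (leaves l)" "a \<notin> set (leaves r)" using notin by auto
    then show ?thesis using Node.prems by simp
  next
    case 4
    then have "a \<notin> set (leaves l)" "b \<notin> set (leaves r)" using notin by auto
    then show ?thesis using Node.prems by simp
  qed
qed auto

text \<open>The weight as a recursion from the front, suited to induction along a prefix.\<close>

fun list_weight :: "(nat \<Rightarrow> nat \<Rightarrow> real) \<Rightarrow> nat list \<Rightarrow> real" where
  "list_weight p [] = 1"
| "list_weight p (x # xs) = prod_list (map (p x) xs) * list_weight p xs"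

lemma prod_list_map_nth: "prod_list (map f xs) = (\<Prod>l<length xs. f (xs ! l))"
proof (induction xs)
  case (Cons x xs)
  then show ?case by (simp add: prod.lessThan_Suc_shift del: prod.lessThan_Suc)
qed simp

lemma weight_eq_list_weight: "weight p \<sigma> = list_weight p \<sigma>"
proof (induction \<sigma>)
  case Nil
  then show ?case by (simp add: weight_def)
next
  case (Cons x xs)
  let ?S = "{(k, l). k < l \<and> l < length xs}"
  have fin: "finite ?S" by (rule finite_subset[of _ "{..<length xs} \<times> {..<length xs}"]) auto
  have S: "{(k, l). k < l \<and> l < length (x # xs)}
      = (\<lambda>l. (0, Suc l)) ` {..<length xs} \<union> (\<lambda>(k, l). (Suc k, Suc l)) ` ?S"
  proof (intro equalityI subsetI)
    fix z assume "z \<in> {(k, l). k < l \<and> l < length (x # xs)}"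
    then obtain k l where z: "z = (k, Suc l)" "k < Suc l" "l < length xs"
      by (auto simp: less_Suc_eq_0_disj)
    then show "z \<in> (\<lambda>l. (0, Suc l)) ` {..<length xs} \<union> (\<lambda>(k, l). (Suc k, Suc l)) ` ?S"
      by (cases k) force+
  qed auto
  have "weight p (x # xs) = (\<Prod>l<length xs. p x (xs ! l)) * (\<Prod>(k, l)\<in>?S. p (xs ! k) (xs ! l))"
    unfolding weight_def S using fin
    by (subst prod.union_disjoint)
      (auto simp: prod.reindex inj_on_def split_def)
  then show ?case using Cons by (simp add: weight_def prod_list_map_nth)
qed

text \<open>Replacing \<open>a\<close> by \<open>b\<close> changes only the factors with the
  elements behind it. The ratio is written crosswise because \<open>p\<close> may take the value
  0.\<close>

lemma list_weight_exchange:
  assumes "\<And>y. y \<in> set ys \<Longrightarrow> p y a = p y b"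
  shows "list_weight p (ys @ b # zs) * prod_list (map (p a) zs)
    = list_weight p (ys @ a # zs) * prod_list (map (p b) zs)"
  using assms
proof (induction ys)
  case (Cons y ys)
  then have "list_weight p (ys @ b # zs) * prod_list (map (p a) zs)
    = list_weight p (ys @ a # zs) * prod_list (map (p b) zs)" "p y a = p y b" by auto
  then show ?case by (simp add: mult.assoc)
qed simp

text \<open>The factors with \<open>ys\<close> agree one by one, those with \<open>xs\<close> and
  \<open>zs\<close> are permuted, and only the factor of the pair itself turns from
  \<open>p a b\<close> into \<open>p b a\<close>.\<close>

lemma list_weight_swap:
  assumes "\<And>y. y \<in> set ys \<Longrightarrow> p y a = p y b \<and> p a y = p b y"
  shows "list_weight p (xs @ a # ys @ b # zs) * p b a = list_weight p (xs @ b # ys @ a # zs) * p a b"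
proof (induction xs)
  case Nil
  have "map (p a) ys = map (p b) ys" using assms by simp
  then have m: "prod_list (map (p a) ys) = prod_list (map (p b) ys)" by (simp only:)
  have e: "list_weight p (ys @ b # zs) * prod_list (map (p a) zs)
    = list_weight p (ys @ a # zs) * prod_list (map (p b) zs)"
    using list_weight_exchange[of ys p a b zs] assms by simp
  show ?case using e by (simp add: m mult.commute)
next
  case (Cons x xs)
  then show ?case by (simp add: ac_simps)
qed

text \<open>Detailed balance for an admissible move: by \<open>lca_outside\<close> the elements in
  between satisfy the hypothesis of \<open>list_weight_swap\<close>.\<close>

lemma weight_balance:
  assumes T: "leaves T = [1..<Suc n]" and p: "league_structure n T p"
    and ab: "(a, b) \<in> leaf_pairs T" and perm: "xs @ a # ys @ b # zs \<in> perms n"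
    and ys: "set ys \<inter> set (leaves (lca T a b)) = {}"
  shows "weight p (xs @ a # ys @ b # zs) * (1 - root_label (lca T a b))
    = weight p (xs @ b # ys @ a # zs) * root_label (lca T a b)"
proof -
  have ab': "1 \<le> a" "a < b" "b \<le> n" "a \<in> set (leaves T)" "b \<in> set (leaves T)"
    using ab by (auto simp: leaf_pairs_def T)
  have pab: "p a b = root_label (lca T a b)" "p b a = 1 - root_label (lca T a b)"
    using p ab' by (auto simp: league_structure_def)
  have sorted: "sorted_wrt (<) (leaves T)" by (simp add: T del: upt_Suc)
  have pd: "distinct (xs @ a # ys @ b # zs)" "set (xs @ a # ys @ b # zs) = {1..n}"
    using perm by (auto simp only: permutations_of_set_def mem_Collect_eq)
  have "p y a = p y b \<and> p a y = p b y" if y: "y \<in> set ys" for y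
  proof -
    have y': "1 \<le> y" "y \<le> n" "y \<noteq> a" "y \<noteq> b" using pd y by auto
    have "y \<in> set (leaves T)" using y' by (auto simp: T)
    then have L: "lca T a y = lca T b y" "lca T y a = lca T y b" "a < y \<longleftrightarrow> b < y"
      using lca_outside[OF sorted ab'(4,5), of y] ys y by auto
    show ?thesis
    proof (cases "a < y")
      case True
      then show ?thesis using p ab' y' L unfolding league_structure_def by (metis less_imp_le order_trans)
    next
      case False
      then have "y < a" "y < b" using L y' by auto
      then show ?thesis using p ab' y' L unfolding league_structure_def by (metis less_imp_le order_trans)
    qed
  qed
  then show ?thesis
    using list_weight_swap[of ys p a b xs zs] by (simp add: weight_eq_list_weight pab)
qed

lemma weight_nonneg:
  assumes T: "leaves T = [1..<Suc n]" and p: "league_structure n T p"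
    and q: "node_labels T \<subseteq> {1/2..1}" and \<sigma>: "\<sigma> \<in> perms n"
  shows "0 \<le> weight p \<sigma>"
proof -
  have dis: "distinct (leaves T)" by (simp add: T del: upt_Suc)
  have r: "0 \<le> p i j \<and> 0 \<le> p j i" if "1 \<le> i" "i < j" "j \<le> n" for i j
  proof -
    have "(i, j) \<in> leaf_pairs T" using that by (auto simp: leaf_pairs_def T)
    from lca_mem(1)[OF this dis] have "root_label (lca T i j) \<in> {1/2..1}" using q by blast
    then show ?thesis using p that unfolding league_structure_def by auto
  qed
  have d: "distinct \<sigma>" "set \<sigma> = {1..n}" using \<sigma> by (auto simp: permutations_of_set_def)
  show ?thesis unfolding weight_def
  proof (rule prod_nonneg, clarify)
    fix k l assume kl: "k < l" "l < length \<sigma>"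
    then have "\<sigma> ! k \<noteq> \<sigma> ! l" using d(1) by (simp add: nth_eq_iff_index_eq)
    moreover have "\<sigma> ! k \<in> {1..n}" "\<sigma> ! l \<in> {1..n}" using kl d(2)[symmetric] by auto
    ultimately show "0 \<le> p (\<sigma> ! k) (\<sigma> ! l)"
      using r[of "\<sigma> ! k" "\<sigma> ! l"] r[of "\<sigma> ! l" "\<sigma> ! k"] by (cases "\<sigma> ! k < \<sigma> ! l") auto
  qed
qed

text \<open>The identity permutation has only factors \<open>p i j\<close> with
  \<open>i < j\<close>, which are labels and hence at least \<open>1/2\<close>. Other permutations
  can have weight 0 when a label is 1.\<close>

lemma sum_weight_pos:
  assumes T: "leaves T = [1..<Suc n]" and p: "league_structure n T p"
    and q: "node_labels T \<subseteq> {1/2..1}"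
  shows "0 < (\<Sum>\<rho>\<in>perms n. weight p \<rho>)"
proof (rule sum_pos2)
  show "[1..<Suc n] \<in> perms n" by (auto simp: permutations_of_set_def simp del: upt_Suc)
  have dis: "distinct (leaves T)" by (simp add: T del: upt_Suc)
  have r: "0 < p i j" if "1 \<le> i" "i < j" "j \<le> n" for i j
  proof -
    have "(i, j) \<in> leaf_pairs T" using that by (auto simp: leaf_pairs_def T)
    from lca_mem(1)[OF this dis] have "root_label (lca T i j) \<in> {1/2..1}" using q by blast
    then show ?thesis using p that unfolding league_structure_def by auto
  qed
  show "0 < weight p [1..<Suc n]" unfolding weight_def
    by (rule prod_pos) (auto simp del: upt_Suc intro!: r)
qed (use weight_nonneg[OF assms] in auto)

text \<open>Transposing \<open>a\<close> and \<open>b\<close> is an involution of the permutations,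
  and by detailed balance the deviations at a permutation and its image cancel. If the move is
  blocked, both deviations vanish, since the elements in between are the same for both.\<close>

lemma pair_update_stationary:
  assumes T: "leaves T = [1..<Suc n]" and p: "league_structure n T p" and ab: "(a, b) \<in> leaf_pairs T"
  shows "(\<Sum>\<sigma>\<in>perms n. weight p \<sigma> * pair_update T f \<sigma> a b) = (\<Sum>\<sigma>\<in>perms n. weight p \<sigma> * f \<sigma>)"
proof -
  define h where "h \<sigma> = weight p \<sigma> * (pair_update T f \<sigma> a b - f \<sigma>)" for \<sigma>
  define q where "q = root_label (lca T a b)"
  define sw where "sw = map (Transposition.transpose a b)"
  have ab': "a \<in> {1..n}" "b \<in> {1..n}" "a \<noteq> b" using ab by (auto simp: leaf_pairs_def T)
  have sw_perm: "sw \<sigma> \<in> perms n" if "\<sigma> \<in> perms n" for \<sigma>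
    using that ab' unfolding sw_def permutations_of_set_def
    by (auto simp: distinct_map inj_on_def transpose_image_eq dest: transpose_eq_imp_eq)
  have sw_sw: "sw (sw \<sigma>) = \<sigma>" for \<sigma> by (simp add: sw_def)
  have key: "h \<sigma> + h (sw \<sigma>) = 0" if \<sigma>: "\<sigma> \<in> perms n" for \<sigma>
  proof -
    have d: "distinct \<sigma>" "set \<sigma> = {1..n}" using \<sigma> by (auto simp: permutations_of_set_def)
    have "a \<in> set \<sigma>" "b \<in> set \<sigma>" using d ab' by auto
    from split_list_two[OF this ab'(3)] obtain xs c ys e zs where dec: "\<sigma> = xs @ c # ys @ e # zs"
      and ce: "(c = a \<and> e = b) \<or> (c = b \<and> e = a)" by metis
    let ?\<alpha> = "xs @ a # ys @ b # zs" and ?\<beta> = "xs @ b # ys @ a # zs"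
    have nin: "a \<notin> set xs \<union> set ys \<union> set zs" "b \<notin> set xs \<union> set ys \<union> set zs"
      using d(1) ce by (auto simp: dec)
    have fix_: "map (Transposition.transpose a b) us = us" if "a \<notin> set us" "b \<notin> set us" for us
      using that by (induction us) (auto simp: transpose_def)
    have sw: "sw ?\<alpha> = ?\<beta>" "sw ?\<beta> = ?\<alpha>" using nin by (auto simp: sw_def fix_)
    have da: "distinct ?\<alpha>" "distinct ?\<beta>" using d(1) ce by (auto simp: dec)
    note facts = place_append[OF da(1)] place_append[OF da(2)] between_append[OF da(1)] between_append[OF da(2)]
    have "h ?\<alpha> + h ?\<beta> = 0"
    proof (cases "set ys \<inter> set (leaves (lca T a b)) = {}")
      case True
      have al: "?\<alpha> \<in> perms n" using \<sigma> sw_perm[OF \<sigma>] ce sw by (auto simp: dec)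
      have upd: "pair_update T f ?\<alpha> a b = q * f ?\<alpha> + (1 - q) * f ?\<beta>"
        "pair_update T f ?\<beta> a b = q * f ?\<alpha> + (1 - q) * f ?\<beta>"
        using True by (simp_all add: pair_update_def facts q_def)
      have "weight p ?\<alpha> * (1 - q) = weight p ?\<beta> * q"
        unfolding q_def by (rule weight_balance[OF T p ab al True])
      moreover have "h ?\<alpha> + h ?\<beta> = (weight p ?\<alpha> * (1 - q)) * (f ?\<beta> - f ?\<alpha>) + (weight p ?\<beta> * q) * (f ?\<alpha> - f ?\<beta>)"
        unfolding h_def upd by (simp add: algebra_simps)
      ultimately have "h ?\<alpha> + h ?\<beta> = (weight p ?\<beta> * q) * (f ?\<beta> - f ?\<alpha>) + (weight p ?\<beta> * q) * (f ?\<alpha> - f ?\<beta>)"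
        by (simp only:)
      then show ?thesis by (simp add: algebra_simps)
    next
      case False
      then show ?thesis by (simp add: h_def pair_update_def facts)
    qed
    then show ?thesis using ce sw by (auto simp: dec)
  qed
  have "(\<Sum>\<sigma>\<in>perms n. h \<sigma>) = (\<Sum>\<sigma>\<in>perms n. h (sw \<sigma>))"
    by (rule sum.reindex_bij_witness[where i = sw and j = sw]) (use sw_perm in \<open>auto simp: sw_sw\<close>)
  then have "2 * (\<Sum>\<sigma>\<in>perms n. h \<sigma>) = (\<Sum>\<sigma>\<in>perms n. h \<sigma> + h (sw \<sigma>))"
    by (simp add: sum.distrib)
  also have "\<dots> = 0" using key by simp
  finally show ?thesis by (simp add: h_def right_diff_distrib sum_subtractf)
qed

lemma tree_op_stationary:
  assumes T: "leaves T = [1..<Suc n]" and p: "league_structure n T p"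
  shows "(\<Sum>\<sigma>\<in>perms n. target n p \<sigma> * tree_op T f \<sigma>)
    = real (card (leaf_pairs T)) * (\<Sum>\<sigma>\<in>perms n. target n p \<sigma> * f \<sigma>)"
proof -
  have "(\<Sum>\<sigma>\<in>perms n. weight p \<sigma> * tree_op T f \<sigma>)
      = (\<Sum>(a, b)\<in>leaf_pairs T. \<Sum>\<sigma>\<in>perms n. weight p \<sigma> * pair_update T f \<sigma> a b)"
    unfolding tree_op_def sum_distrib_left split_def by (rule sum.swap)
  also have "\<dots> = (\<Sum>x\<in>leaf_pairs T. \<Sum>\<sigma>\<in>perms n. weight p \<sigma> * f \<sigma>)"
    using pair_update_stationary[OF T p] by (intro sum.cong) auto
  finally have "(\<Sum>\<sigma>\<in>perms n. weight p \<sigma> * tree_op T f \<sigma>)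
      = real (card (leaf_pairs T)) * (\<Sum>\<sigma>\<in>perms n. weight p \<sigma> * f \<sigma>)" by simp
  then show ?thesis
    by (simp add: target_def sum_divide_distrib[symmetric])
qed

section \<open>Mixing time\<close>

lemma leaf_pairs_upt:
  assumes "leaves T = [1..<Suc n]"
  shows "leaf_pairs T = {(a, b). 1 \<le> a \<and> a < b \<and> b \<le> n}"
  using assms by (auto simp: leaf_pairs_def)

lemma tree_perms_upt:
  assumes "leaves T = [1..<Suc n]"
  shows "tree_perms T = perms n"
proof -
  have "set (leaves T) = {1..n}" using assms by (auto simp del: upt_Suc)
  then show ?thesis by simp
qed

lemma card_leaf_pairs_bounds:
  assumes T: "leaves T = [1..<Suc n]" and n: "2 \<le> n"
  shows "1 \<le> card (leaf_pairs T)" "card (leaf_pairs T) \<le> n ^ 2"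
proof -
  have "(1, 2) \<in> leaf_pairs T" using n by (simp add: leaf_pairs_upt[OF T])
  then show "1 \<le> card (leaf_pairs T)" using card_gt_0_iff[of "leaf_pairs T"] by fastforce
  have "card (leaf_pairs T) \<le> card ({1..n} \<times> {1..n})"
    by (rule card_mono) (auto simp: leaf_pairs_upt[OF T])
  then show "card (leaf_pairs T) \<le> n ^ 2" by (simp add: card_cartesian_product power2_eq_square)
qed

text \<open>The bridge from the probabilistic definition to \<open>tree_op\<close>. The labels lie
  in the unit interval, where \<open>bernoulli_pmf\<close> has the stated bias.\<close>

lemma expectation_tree_step:
  assumes T: "leaves T = [1..<Suc n]" and n: "2 \<le> n" and p: "league_structure n T p"
    and q: "node_labels T \<subseteq> {1/2..1}"
  shows "measure_pmf.expectation (tree_step n T p \<sigma>) f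
    = tree_op T f \<sigma> / real (card (leaf_pairs T))"
proof -
  have dis: "distinct (leaves T)" by (simp add: T del: upt_Suc)
  let ?K = "\<lambda>(a, b). if between \<sigma> a b \<inter> set (leaves (lca T a b)) = {}
       then map_pmf (\<lambda>in_order. if in_order then place \<sigma> a b else place \<sigma> b a)
              (bernoulli_pmf (p a b))
       else return_pmf \<sigma>"
  have E: "measure_pmf.expectation (?K (a, b)) f = pair_update T f \<sigma> a b"
    if ab: "(a, b) \<in> leaf_pairs T" for a b
  proof -
    have "p a b = root_label (lca T a b)"
      using ab p unfolding league_structure_def leaf_pairs_upt[OF T] by auto
    moreover have "root_label (lca T a b) \<in> {1/2..1}" using lca_mem(1)[OF ab dis] q by blast
    ultimately show ?thesis by (simp add: pair_update_def mult.commute)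
  qed
  have ne: "leaf_pairs T \<noteq> {}" using card_leaf_pairs_bounds(1)[OF T n] by auto
  have "measure_pmf.expectation (tree_step n T p \<sigma>) f =
    (\<Sum>x\<in>leaf_pairs T. measure_pmf.expectation (?K x) f /\<^sub>R real (card (leaf_pairs T)))"
    unfolding tree_step_def leaf_pairs_upt[OF T, symmetric]
    by (rule pmf_expectation_bind_pmf_of_set) (use ne in \<open>auto split: if_splits\<close>)
  also have "\<dots> = (\<Sum>x\<in>leaf_pairs T. pair_update T f \<sigma> (fst x) (snd x) / real (card (leaf_pairs T)))"
    using E by (intro sum.cong refl) (auto simp: divide_inverse_commute)
  finally show ?thesis by (simp add: tree_op_def split_def sum_divide_distrib)
qed

lemma set_pmf_tree_step:
  assumes T: "leaves T = [1..<Suc n]" and n: "2 \<le> n" and \<sigma>: "\<sigma> \<in> perms n"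
  shows "set_pmf (tree_step n T p \<sigma>) \<subseteq> perms n"
proof -
  have ne: "leaf_pairs T \<noteq> {}" using card_leaf_pairs_bounds(1)[OF T n] by auto
  have "place \<sigma> a b \<in> perms n" "place \<sigma> b a \<in> perms n" if "(a, b) \<in> leaf_pairs T" for a b
  proof -
    have "a \<in> {1..n}" "b \<in> {1..n}" "a \<noteq> b" using that by (auto simp: leaf_pairs_upt[OF T])
    then show "place \<sigma> a b \<in> perms n" "place \<sigma> b a \<in> perms n"
      using place_in_permutations[OF \<sigma>] by blast+
  qed
  then show ?thesis
    unfolding tree_step_def leaf_pairs_upt[OF T, symmetric]
    using \<sigma> ne by (auto simp: set_pmf_of_set split: if_splits)
qed

lemma chain_dist_Suc: "chain_dist K (Suc t) x = bind_pmf (chain_dist K t x) K"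
  by (simp add: chain_dist_def)

lemma set_pmf_chain_dist:
  assumes "\<And>y. y \<in> S \<Longrightarrow> set_pmf (K y) \<subseteq> S" "x \<in> S"
  shows "set_pmf (chain_dist K t x) \<subseteq> S"
proof (induction t)
  case 0
  then show ?case using assms by (simp add: chain_dist_def)
next
  case (Suc t)
  then show ?case using assms by (auto simp: chain_dist_Suc)
qed

text \<open>Induction on \<open>t\<close> for all functions at once: one step is moved from the
  distribution to the function, stationarity keeps the target mean, and the Lipschitz constant
  shrinks. At \<open>t = 0\<close> the oscillation remains: fewer than \<open>n\<close> nodes, at
  most \<open>2 ^ n\<close> exchanges at each, weights at most \<open>3 ^ n * n^2\<close>.\<close>

lemma chain_dist_contract:
  assumes T: "leaves T = [1..<Suc n]" and n: "2 \<le> n" and p: "league_structure n T p"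
    and q: "node_labels T \<subseteq> {1/2..1}" and c: "\<forall>q\<in>node_labels T. contraction_rate n \<gamma> q"
    and \<gamma>: "\<gamma> \<le> 1" and x: "x \<in> perms n" and A: "0 \<le> A" and f: "lipschitz_tree T A f"
  shows "\<bar>measure_pmf.expectation (chain_dist (tree_step n T p) t x) f
           - (\<Sum>\<sigma>\<in>perms n. target n p \<sigma> * f \<sigma>)\<bar>
    \<le> real n * (2 ^ n * (3 ^ n * real n ^ 2)) * A * (1 - \<gamma> / real (card (leaf_pairs T))) ^ t"
  using A f
proof (induction t arbitrary: A f)
  case 0
  let ?D = "real n * (2 ^ n * (3 ^ n * real n ^ 2)) * A"
  have dis: "distinct (leaves T)" and len: "length (leaves T) \<le> n"
    by (simp_all add: T del: upt_Suc)
  have lab: "\<forall>q\<in>node_labels T. 1/2 \<le> q" using q by auto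
  have edge: "\<bar>f \<sigma> - f \<sigma>'\<bar> \<le> A * (3 ^ n * real n ^ 2)" if "edge T \<sigma> \<sigma>' y" for \<sigma> \<sigma>' y
  proof -
    have "\<bar>f \<sigma> - f \<sigma>'\<bar> \<le> A * y" using 0(2) that by (simp add: lipschitz_tree_def)
    also have "\<dots> \<le> A * (3 ^ n * real n ^ 2)"
      using edge_weight_bounds[OF that len lab] 0(1) by (intro mult_left_mono) auto
    finally show ?thesis .
  qed
  have diff: "\<bar>f x - f \<sigma>\<bar> \<le> ?D" if "\<sigma> \<in> perms n" for \<sigma>
  proof -
    have "x \<in> tree_perms T" "\<sigma> \<in> tree_perms T" using x that unfolding tree_perms_upt[OF T] by auto
    then have "\<bar>f x - f \<sigma>\<bar> \<le> (real (length (leaves T)) - 1) * (2 ^ n * (A * (3 ^ n * real n ^ 2)))"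
      using edge 0(1) by (intro tree_path_bound dis len) auto
    also have "\<dots> \<le> real n * (2 ^ n * (A * (3 ^ n * real n ^ 2)))"
      using 0(1) by (intro mult_right_mono) (auto simp: T)
    finally show ?thesis by (simp add: mult_ac)
  qed
  have tot: "(\<Sum>\<sigma>\<in>perms n. target n p \<sigma>) = 1"
    using sum_weight_pos[OF T p q] by (simp add: target_def sum_divide_distrib[symmetric])
  have nn: "0 \<le> target n p \<sigma>" if "\<sigma> \<in> perms n" for \<sigma>
    using weight_nonneg[OF T p q that] sum_weight_pos[OF T p q] by (simp add: target_def)
  have "f x - (\<Sum>\<sigma>\<in>perms n. target n p \<sigma> * f \<sigma>) = (\<Sum>\<sigma>\<in>perms n. target n p \<sigma> * (f x - f \<sigma>))"
    using tot by (simp add: right_diff_distrib sum_subtractf sum_distrib_right[symmetric])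
  also have "\<bar>\<dots>\<bar> \<le> (\<Sum>\<sigma>\<in>perms n. target n p \<sigma> * ?D)"
    using diff nn by (intro order_trans[OF sum_abs] sum_mono) (auto simp: abs_mult intro!: mult_left_mono)
  also have "\<dots> = ?D" using tot by (simp only: sum_distrib_right[symmetric] mult_1_left)
  finally show ?case by (simp add: chain_dist_def)
next
  case (Suc t)
  let ?N = "real (card (leaf_pairs T))" and ?K = "tree_step n T p"
  have N: "1 \<le> ?N" using card_leaf_pairs_bounds(1)[OF T n] by simp
  define g where "g \<sigma> = tree_op T f \<sigma> / ?N" for \<sigma>
  have sorted: "sorted_wrt (<) (leaves T)" "length (leaves T) \<le> n" by (simp_all add: T del: upt_Suc)
  \<comment> \<open>The bound \<open>\<gamma> \<le> 1\<close> keeps the new Lipschitz constant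
    nonnegative, as the induction hypothesis demands.\<close>
  have A': "0 \<le> (1 - \<gamma> / ?N) * A"
  proof -
    have "\<gamma> / ?N \<le> 1" using N \<gamma> by (simp add: field_simps)
    then show ?thesis using Suc.prems(1) by simp
  qed
  have g: "lipschitz_tree T ((1 - \<gamma> / ?N) * A) g"
    unfolding lipschitz_tree_def
  proof (intro allI impI)
    fix \<sigma> \<sigma>' y assume "edge T \<sigma> \<sigma>' y"
    then have "\<bar>tree_op T f \<sigma> - tree_op T f \<sigma>'\<bar> \<le> (?N - \<gamma>) * A * y"
      using tree_op_contract[OF sorted c Suc.prems] by (simp add: lipschitz_tree_def)
    then have "\<bar>tree_op T f \<sigma> - tree_op T f \<sigma>'\<bar> / ?N \<le> (?N - \<gamma>) * A * y / ?N"
      using N by (intro divide_right_mono) auto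
    moreover have "?N \<noteq> 0" using N by linarith
    then have "1 - \<gamma> / ?N = (?N - \<gamma>) / ?N" by (simp add: diff_divide_distrib)
    then have "(?N - \<gamma>) * A * y / ?N = (1 - \<gamma> / ?N) * A * y" by simp
    moreover have "\<bar>g \<sigma> - g \<sigma>'\<bar> = \<bar>tree_op T f \<sigma> - tree_op T f \<sigma>'\<bar> / ?N"
      using N by (simp add: g_def diff_divide_distrib[symmetric])
    ultimately show "\<bar>g \<sigma> - g \<sigma>'\<bar> \<le> (1 - \<gamma> / ?N) * A * y" by simp
  qed
  have sub: "set_pmf (chain_dist ?K t x) \<subseteq> perms n"
    using set_pmf_chain_dist[of "perms n" ?K] set_pmf_tree_step[OF T n] x by blast
  have fin: "finite (set_pmf (?K \<sigma>))" if "\<sigma> \<in> perms n" for \<sigma>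
    by (rule finite_subset[OF set_pmf_tree_step[OF T n that]]) simp
  have gK: "g \<sigma> = measure_pmf.expectation (?K \<sigma>) f" for \<sigma>
    using expectation_tree_step[OF T n p q] by (simp only: g_def)
  have "measure_pmf.expectation (chain_dist ?K (Suc t) x) f
      = (\<Sum>\<sigma>\<in>perms n. pmf (chain_dist ?K t x) \<sigma> *\<^sub>R g \<sigma>)"
    unfolding chain_dist_Suc gK using sub fin by (intro pmf_expectation_bind) auto
  also have "\<dots> = measure_pmf.expectation (chain_dist ?K t x) g"
    using sub by (intro integral_measure_pmf[symmetric]) auto
  finally have 1: "measure_pmf.expectation (chain_dist ?K (Suc t) x) f
      = measure_pmf.expectation (chain_dist ?K t x) g" .
  have 2: "(\<Sum>\<sigma>\<in>perms n. target n p \<sigma> * f \<sigma>) = (\<Sum>\<sigma>\<in>perms n. target n p \<sigma> * g \<sigma>)"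
  proof -
    have "(\<Sum>\<sigma>\<in>perms n. target n p \<sigma> * g \<sigma>) = (\<Sum>\<sigma>\<in>perms n. target n p \<sigma> * tree_op T f \<sigma>) / ?N"
      by (simp add: g_def sum_divide_distrib)
    also have "\<dots> = ?N * (\<Sum>\<sigma>\<in>perms n. target n p \<sigma> * f \<sigma>) / ?N"
      by (simp only: tree_op_stationary[OF T p])
    also have "\<dots> = (\<Sum>\<sigma>\<in>perms n. target n p \<sigma> * f \<sigma>)"
      using N by (intro nonzero_mult_div_cancel_left) linarith
    finally show ?thesis ..
  qed
  show ?case unfolding 1 2 using Suc.IH[OF A' g] by (simp add: mult_ac)
qed

text \<open>The sum of absolute differences is the difference of the two means of their sign
  function. That function varies by at most 2 along an edge of weight at least
  \<open>1 / 3 ^ n\<close>, so its Lipschitz constant is at most \<open>2 * 3 ^ n\<close>; with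
  \<open>2 ^ n * 3 ^ n\<close> from \<open>chain_dist_contract\<close> this gives
  \<open>18 ^ n\<close>, and the 2 cancels against the \<open>1/2\<close> in the distance.\<close>

lemma tv_dist_tree_le:
  assumes T: "leaves T = [1..<Suc n]" and n: "2 \<le> n" and p: "league_structure n T p"
    and q: "node_labels T \<subseteq> {1/2..1}" and c: "\<forall>q\<in>node_labels T. contraction_rate n \<gamma> q"
    and \<gamma>: "\<gamma> \<le> 1"
  shows "tv_dist (perms n) (tree_step n T p) (target n p) t
    \<le> 18 ^ n * real n ^ 3 * (1 - \<gamma> / real (card (leaf_pairs T))) ^ t"
proof -
  let ?K = "tree_step n T p" and ?N = "real (card (leaf_pairs T))"
  have len: "length (leaves T) \<le> n" by (simp add: T del: upt_Suc)
  have lab: "\<forall>q\<in>node_labels T. 1/2 \<le> q" using q by auto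
  have "1/2 * (\<Sum>y\<in>perms n. \<bar>pmf (chain_dist ?K t x) y - target n p y\<bar>)
      \<le> 18 ^ n * real n ^ 3 * (1 - \<gamma> / ?N) ^ t" if x: "x \<in> perms n" for x
  proof -
    define f where "f y = sgn (pmf (chain_dist ?K t x) y - target n p y)" for y
    have lip: "lipschitz_tree T (2 * 3 ^ n) f"
      unfolding lipschitz_tree_def
    proof (intro allI impI)
      fix \<sigma> \<sigma>' y assume e: "edge T \<sigma> \<sigma>' y"
      have "\<bar>f z\<bar> \<le> 1" for z by (simp add: f_def abs_sgn_eq)
      from this[of \<sigma>] this[of \<sigma>'] have "\<bar>f \<sigma> - f \<sigma>'\<bar> \<le> 2" by linarith
      also have "2 \<le> 2 * 3 ^ n * y"
        using edge_weight_bounds[OF e len lab] by (simp add: field_simps)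
      finally show "\<bar>f \<sigma> - f \<sigma>'\<bar> \<le> 2 * 3 ^ n * y" .
    qed
    have sub: "set_pmf (chain_dist ?K t x) \<subseteq> perms n"
      using set_pmf_chain_dist[of "perms n" ?K] set_pmf_tree_step[OF T n] x by blast
    have E: "measure_pmf.expectation (chain_dist ?K t x) f
        = (\<Sum>y\<in>perms n. f y * pmf (chain_dist ?K t x) y)"
      using sub by (intro integral_measure_pmf_real) auto
    have "(\<Sum>y\<in>perms n. \<bar>pmf (chain_dist ?K t x) y - target n p y\<bar>)
        = (\<Sum>y\<in>perms n. f y * (pmf (chain_dist ?K t x) y - target n p y))"
      by (intro sum.cong refl) (simp add: f_def abs_sgn mult.commute)
    also have "\<dots> = measure_pmf.expectation (chain_dist ?K t x) f - (\<Sum>\<sigma>\<in>perms n. target n p \<sigma> * f \<sigma>)"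
      by (simp add: E right_diff_distrib sum_subtractf mult.commute)
    also have "\<dots> \<le> real n * (2 ^ n * (3 ^ n * real n ^ 2)) * (2 * 3 ^ n) * (1 - \<gamma> / ?N) ^ t"
      using chain_dist_contract[OF T n p q c \<gamma> x _ lip, of t] by simp
    also have "\<dots> = 2 * (18 ^ n * real n ^ 3 * (1 - \<gamma> / ?N) ^ t)"
    proof -
      have "(18::real) ^ n = 2 ^ n * 3 ^ n * 3 ^ n" by (simp add: power_mult_distrib[symmetric])
      then show ?thesis by (simp add: power2_eq_square power3_eq_cube)
    qed
    finally show ?thesis by simp
  qed
  then show ?thesis
    unfolding tv_dist_def by (subst Max_le_iff) (auto simp: permutations_of_set_empty_iff)
qed

lemma one_le_ln:
  assumes "3 \<le> n"
  shows "1 \<le> ln (real n)"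
proof -
  have "exp 1 \<le> (3::real)" by (rule exp_le)
  also have "\<dots> \<le> real n" using assms by simp
  finally show ?thesis using assms by (simp add: ln_ge_iff)
qed

text \<open>The logarithm of \<open>18 ^ n * n ^ 3 / \<epsilon>\<close> is at most
  \<open>20 * n * ln (n / \<epsilon>)\<close>: 17 from \<open>ln 18 \<le> 17\<close>, 3 from the
  cube together with \<open>1 / \<epsilon>\<close>. The number of pairs, at most \<open>n^2\<close>,
  raises \<open>n\<close> to \<open>n ^ 3\<close>, and the final 1 pays for rounding up.\<close>

lemma tau_tree_le:
  assumes T: "leaves T = [1..<Suc n]" and n: "3 \<le> n" and p: "league_structure n T p"
    and q: "node_labels T \<subseteq> {1/2..1}" and c: "\<forall>q\<in>node_labels T. contraction_rate n \<gamma> q"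
    and \<gamma>: "0 < \<gamma>" "\<gamma> \<le> 1" and \<epsilon>: "0 < \<epsilon>" "\<epsilon> < 1"
  shows "ereal_of_enat (tau_tree n T p \<epsilon>)
    \<le> ereal (20 / \<gamma> * real n ^ 3 * ln (real n / \<epsilon>) + 1)"
proof -
  let ?N = "real (card (leaf_pairs T))" and ?L = "ln (real n / \<epsilon>)"
  have N: "1 \<le> ?N" "?N \<le> real n ^ 2"
    using card_leaf_pairs_bounds[OF T] n by (simp_all flip: of_nat_power)
  have L: "1 \<le> ln (real n)" "ln (real n) \<le> ?L" "ln (1 / \<epsilon>) = ?L - ln (real n)"
  proof -
    show "1 \<le> ln (real n)" using one_le_ln[OF n] .
    show "ln (real n) \<le> ?L" "ln (1 / \<epsilon>) = ?L - ln (real n)"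
      using n \<epsilon> by (simp_all add: ln_div)
  qed
  define t0 where "t0 = 20 / \<gamma> * real n ^ 3 * ?L"
  define t where "t = nat \<lceil>t0\<rceil>"
  have t0: "0 \<le> t0" unfolding t0_def using \<gamma> L by simp
  have le: "tv_dist (perms n) (tree_step n T p) (target n p) t' \<le> \<epsilon>" if t': "t \<le> t'" for t'
  proof -
    have "t0 \<le> real t'" using t' t0 unfolding t_def by linarith
    then have "\<gamma> / ?N * t0 \<le> \<gamma> / ?N * real t'" using \<gamma> N by (intro mult_left_mono) auto
    moreover have "20 * real n * ?L \<le> \<gamma> / ?N * t0"
    proof -
      have "20 * real n * ?L * ?N \<le> 20 * real n * ?L * real n ^ 2"
        using N L by (intro mult_left_mono) auto
      then show ?thesis using \<gamma> N by (simp add: t0_def field_simps power2_eq_square power3_eq_cube)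
    qed
    ultimately have e: "20 * real n * ?L \<le> \<gamma> / ?N * real t'" by simp
    have "ln (18 ^ n * real n ^ 3 * (1 / \<epsilon>)) = real n * ln 18 + 3 * ln (real n) + ln (1 / \<epsilon>)"
      using n \<epsilon> by (simp add: ln_mult ln_div ln_realpow)
    also have "\<dots> \<le> real n * 17 + 3 * ?L"
    proof -
      have "real n * ln 18 \<le> real n * 17" using ln_le_minus_one[of 18] by (intro mult_left_mono) auto
      then show ?thesis using L by linarith
    qed
    also have "\<dots> \<le> 17 * real n * ?L + 3 * real n * ?L"
    proof -
      have "17 * real n * 1 \<le> 17 * real n * ?L" using L by (intro mult_left_mono) auto
      moreover have "3 * ?L \<le> 3 * real n * ?L" using L n by (intro mult_right_mono) auto
      ultimately show ?thesis by linarith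
    qed
    also have "\<dots> \<le> \<gamma> / ?N * real t'" using e by (simp add: algebra_simps)
    finally have "exp (ln (18 ^ n * real n ^ 3 * (1 / \<epsilon>))) \<le> exp (\<gamma> / ?N * real t')" by simp
    moreover have "exp (ln (18 ^ n * real n ^ 3 * (1 / \<epsilon>))) = 18 ^ n * real n ^ 3 * (1 / \<epsilon>)"
      using n \<epsilon> by (intro exp_ln) simp
    ultimately have "18 ^ n * real n ^ 3 * (1 / \<epsilon>) \<le> exp (\<gamma> / ?N * real t')" by (simp only:)
    then have f: "18 ^ n * real n ^ 3 * exp (- (\<gamma> / ?N * real t')) \<le> \<epsilon>"
      using \<epsilon> by (simp add: exp_minus field_simps)
    have "\<gamma> / ?N \<le> 1" using \<gamma> N by (simp add: field_simps)
    then have "(1 - \<gamma> / ?N) ^ t' \<le> exp (- (\<gamma> / ?N)) ^ t'"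
      using exp_ge_add_one_self[of "- (\<gamma> / ?N)"] by (intro power_mono) auto
    also have "\<dots> = exp (- (\<gamma> / ?N * real t'))" by (simp add: exp_of_nat_mult[symmetric] mult.commute)
    finally have "18 ^ n * real n ^ 3 * (1 - \<gamma> / ?N) ^ t'
        \<le> 18 ^ n * real n ^ 3 * exp (- (\<gamma> / ?N * real t'))"
      by (intro mult_left_mono) auto
    moreover have "2 \<le> n" using n by simp
    ultimately show ?thesis
      using tv_dist_tree_le[OF T _ p q c \<gamma>(2), of t'] f by (meson order_trans)
  qed
  have "tau_tree n T p \<epsilon> \<le> enat t"
    unfolding tau_tree_def mixing_time_def using le by (intro Inf_lower) auto
  then have "ereal_of_enat (tau_tree n T p \<epsilon>) \<le> ereal (real t)"
    by (metis ereal_of_enat_le_iff ereal_of_enat_simps(1))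
  also have "real t \<le> t0 + 1" unfolding t_def using t0 by linarith
  finally show ?thesis by (simp add: t0_def)
qed

theorem theorem5:
  shows "(\<exists>C>0. \<forall>\<^sub>F n in sequentially. \<forall>T p \<epsilon>.
            leaves T = [1..<Suc n] \<and> node_labels T \<subseteq> {1/2..1} \<and> league_structure n T p \<and>
            0 < \<epsilon> \<and> \<epsilon> < 1 \<longrightarrow>
            ereal_of_enat (tau_tree n T p \<epsilon>) \<le> ereal (C * real n ^ 5 * ln (real n / \<epsilon>)))
       \<and> (\<forall>\<delta>>0. \<exists>C>0. \<forall>\<^sub>F n in sequentially. \<forall>T p \<epsilon>.
            leaves T = [1..<Suc n] \<and> node_labels T \<subseteq> {1/2 + \<delta>..1} \<and> league_structure n T p \<and>
            0 < \<epsilon> \<and> \<epsilon> < 1 \<longrightarrow>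
            ereal_of_enat (tau_tree n T p \<epsilon>)
              \<le> ereal (C * real n ^ 3 * ln (real n) * ln (real n / \<epsilon>)))"
proof (intro conjI allI impI)
  have L: "1 \<le> ln (real n)" "1 \<le> ln (real n / \<epsilon>)" if "3 \<le> n" "0 < \<epsilon>" "\<epsilon> < 1" for n and \<epsilon> :: real
  proof -
    show "1 \<le> ln (real n)" using one_le_ln[OF that(1)] .
    moreover have "ln (real n / \<epsilon>) = ln (real n) - ln \<epsilon>" "ln \<epsilon> < 0"
      using that by (simp_all add: ln_div)
    ultimately show "1 \<le> ln (real n / \<epsilon>)" by linarith
  qed
  show "\<exists>C>0. \<forall>\<^sub>F n in sequentially. \<forall>T p \<epsilon>.
            leaves T = [1..<Suc n] \<and> node_labels T \<subseteq> {1/2..1} \<and> league_structure n T p \<and>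
            0 < \<epsilon> \<and> \<epsilon> < 1 \<longrightarrow>
            ereal_of_enat (tau_tree n T p \<epsilon>) \<le> ereal (C * real n ^ 5 * ln (real n / \<epsilon>))"
  proof (intro exI[of _ 6] conjI eventually_sequentiallyI[of 3] allI impI)
    fix n T p and \<epsilon> :: real
    assume n: "3 \<le> n" and a: "leaves T = [1..<Suc n] \<and> node_labels T \<subseteq> {1/2..1} \<and>
      league_structure n T p \<and> 0 < \<epsilon> \<and> \<epsilon> < 1"
    have n2: "4 \<le> real n ^ 2" using n power_mono[of 3 "real n" 2] by simp
    have "ereal_of_enat (tau_tree n T p \<epsilon>)
        \<le> ereal (20 / (4 / real n ^ 2) * real n ^ 3 * ln (real n / \<epsilon>) + 1)"
    proof (rule tau_tree_le)
      show "\<forall>q\<in>node_labels T. contraction_rate n (4 / real n ^ 2) q"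
        using a by (auto intro!: contraction_rate_uniform)
    qed (use a n n2 in \<open>auto simp: field_simps\<close>)
    \<comment> \<open>The rate \<open>4 / n^2\<close> turns the main term into five copies of
      \<open>n ^ 5 * ln (n / \<epsilon>)\<close>; a sixth absorbs the rounding term.\<close>
    also have "20 / (4 / real n ^ 2) * real n ^ 3 * ln (real n / \<epsilon>) + 1
        \<le> 6 * real n ^ 5 * ln (real n / \<epsilon>)"
    proof -
      have "1 * 1 \<le> real n ^ 5 * ln (real n / \<epsilon>)"
        using L[of n \<epsilon>] n a by (intro mult_mono one_le_power) auto
      moreover have "20 / (4 / real n ^ 2) * real n ^ 3 = 5 * real n ^ 5"
        by (simp add: power_add[symmetric])
      ultimately show ?thesis by (simp only:)
    qed
    finally show "ereal_of_enat (tau_tree n T p \<epsilon>) \<le> ereal (6 * real n ^ 5 * ln (real n / \<epsilon>))"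
      by simp
  qed simp
  fix \<delta> :: real assume \<delta>: "0 < \<delta>"
  define \<gamma> where "\<gamma> = min (2 * \<delta>^2) (1/4)"
  have \<gamma>: "0 < \<gamma>" "\<gamma> \<le> 1" using \<delta> by (auto simp: \<gamma>_def)
  show "\<exists>C>0. \<forall>\<^sub>F n in sequentially. \<forall>T p \<epsilon>.
            leaves T = [1..<Suc n] \<and> node_labels T \<subseteq> {1/2 + \<delta>..1} \<and> league_structure n T p \<and>
            0 < \<epsilon> \<and> \<epsilon> < 1 \<longrightarrow>
            ereal_of_enat (tau_tree n T p \<epsilon>)
              \<le> ereal (C * real n ^ 3 * ln (real n) * ln (real n / \<epsilon>))"
  proof (intro exI[of _ "20 / \<gamma> + 1"] conjI eventually_sequentiallyI[of 3] allI impI)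
    fix n T p and \<epsilon> :: real
    assume n: "3 \<le> n" and a: "leaves T = [1..<Suc n] \<and> node_labels T \<subseteq> {1/2 + \<delta>..1} \<and>
      league_structure n T p \<and> 0 < \<epsilon> \<and> \<epsilon> < 1"
    let ?X = "real n ^ 3 * ln (real n / \<epsilon>)"
    have sub: "{1/2 + \<delta>..1} \<subseteq> {1/2..1::real}" using \<delta> by auto
    have "ereal_of_enat (tau_tree n T p \<epsilon>) \<le> ereal (20 / \<gamma> * real n ^ 3 * ln (real n / \<epsilon>) + 1)"
    proof (rule tau_tree_le)
      show "\<forall>q\<in>node_labels T. contraction_rate n \<gamma> q"
        using a \<delta> by (auto simp: \<gamma>_def intro!: contraction_rate_biased)
      show "node_labels T \<subseteq> {1/2..1}" using a sub by blast
    qed (use a n \<gamma> in auto)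
    \<comment> \<open>The 1 added to the constant absorbs the rounding term, and the factor
      \<open>ln (real n)\<close>, at least 1, is inserted to reach the stated form.\<close>
    also have "20 / \<gamma> * real n ^ 3 * ln (real n / \<epsilon>) + 1
        \<le> (20 / \<gamma> + 1) * real n ^ 3 * ln (real n) * ln (real n / \<epsilon>)"
    proof -
      have X: "1 * 1 \<le> ?X" using L[of n \<epsilon>] n a by (intro mult_mono one_le_power) auto
      have "20 / \<gamma> * real n ^ 3 * ln (real n / \<epsilon>) + 1 \<le> (20 / \<gamma> + 1) * ?X * 1"
        using X by (simp add: algebra_simps)
      also have "\<dots> \<le> (20 / \<gamma> + 1) * ?X * ln (real n)"
        using L(1)[of n \<epsilon>] n a X \<gamma> by (intro mult_left_mono) auto
      finally show ?thesis by (simp add: mult_ac)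
    qed
    finally show "ereal_of_enat (tau_tree n T p \<epsilon>)
        \<le> ereal ((20 / \<gamma> + 1) * real n ^ 3 * ln (real n) * ln (real n / \<epsilon>))"
      by simp
  qed (use \<gamma> in \<open>simp add: add_pos_pos\<close>)
qed

end
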